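(* Let $a\ge0$, $b>0$, $c\in\mathbf{R}$. Let $V$ be the bounded solution of $$V_t=V_{yy}-a^2(V-1)-2b\,\delta_0\,V\quad\text{in }\mathbf{R}\times(0,\infty)$$ with initial data $V(y,0)=1-ce^{-a|y|}$, where $\delta_0$ is the Dirac delta at $y=0$. Then $\xi(t)=V(0,t)$ solves $$\int_0^t m_a(t-s)\,\xi_s(s)\,ds=-\operatorname{grad}E^{0,b}_{\mathrm{sMM}}(\xi(t)),\qquad t>0,$$ with $$m_a(t)=2\left\{f^{a^2}_{1/2}(t)+a^2\int_0^t f^{a^2}_{1/2}(s)\,ds-a\right\}.$$ Moreover, $m_a'(t)<0$ and $m_a(t)>0$ for $t>0$, and $\lim_{t\to\infty}m_a(t)=0$.
   Context: The equation is understood in the distributional sense (i.e. $V$ is continuous across $y=0$, solves the equation without the delta term for $y\neq0$, and $V_y(0+,t)-V_y(0-,t)=2bV(0,t)$). For $\alpha\in\mathbf{R}$, $\beta>0$, $f^\alpha_\beta(t)=e^{-\alpha t}t^{\beta-1}/\Gamma(\beta)$ for $t>0$. The energy is $E^{0,b}_{\mathrm{sMM}}(\zeta)=b\zeta^2+a(\zeta-1)^2$, and $\operatorname{grad}E^{0,b}_{\mathrm{sMM}}(\zeta)=2b\zeta+2a(\zeta-1)$ is its derivative. $\xi_s$ denotes the derivative of $\xi$. *)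

theory Defs
  imports "HOL-Analysis.Analysis"
begin

text \<open>The function \<open>f\<^sup>\<alpha>\<^sub>\<beta>\<close>; only its values at \<open>t > 0\<close> are meaningful.\<close>

definition f_kernel :: "real \<Rightarrow> real \<Rightarrow> real \<Rightarrow> real" where
  "f_kernel \<alpha> \<beta> t = exp (- \<alpha> * t) * t powr (\<beta> - 1) / Gamma \<beta>"

definition m_kernel :: "real \<Rightarrow> real \<Rightarrow> real" where
  "m_kernel a t =
     2 * (f_kernel (a\<^sup>2) (1/2) t
          + a\<^sup>2 * (LINT s:{0<..<t}|lborel. f_kernel (a\<^sup>2) (1/2) s) - a)"

definition E_sMM :: "real \<Rightarrow> real \<Rightarrow> real \<Rightarrow> real" where
  "E_sMM a b \<zeta> = b * \<zeta>\<^sup>2 + a * (\<zeta> - 1)\<^sup>2"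

definition grad_E_sMM :: "real \<Rightarrow> real \<Rightarrow> real \<Rightarrow> real" where
  "grad_E_sMM a b \<zeta> = deriv (E_sMM a b) \<zeta>"

lemma grad_E_sMM_eq: "grad_E_sMM a b \<zeta> = 2 * b * \<zeta> + 2 * a * (\<zeta> - 1)"
  unfolding grad_E_sMM_def
  by (rule DERIV_imp_deriv)
     (auto simp: E_sMM_def[abs_def] intro!: derivative_eq_intros)

text \<open>
  \<open>V\<close> (first argument space, second argument time) is a bounded solution of
  \<open>V\<^sub>t = V\<^sub>y\<^sub>y - a\<^sup>2 (V - 1) - 2 b \<delta>\<^sub>0 V\<close> on \<open>\<real> \<times> (0,\<infinity>)\<close> with initial data \<open>v\<^sub>0\<close>.
  The Dirac term is encoded by continuity of \<open>V\<close> across \<open>y = 0\<close>, the equation without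
  the Dirac term for \<open>y \<noteq> 0\<close>, and the jump condition for \<open>V\<^sub>y\<close> at \<open>y = 0\<close>, with
  \<open>V\<^sub>y(0+,t)\<close> and \<open>V\<^sub>y(0-,t)\<close> the one-sided limits \<open>p\<close> and \<open>q\<close> of \<open>V\<^sub>y(y,t)\<close>.
  Continuity up to \<open>t = 0\<close> is what makes the initial condition meaningful. Since \<open>deriv\<close>
  is total, differentiability is required explicitly; the derivatives need not be
  continuous.
\<close>

definition bounded_delta_solution ::
  "real \<Rightarrow> real \<Rightarrow> (real \<Rightarrow> real) \<Rightarrow> (real \<Rightarrow> real \<Rightarrow> real) \<Rightarrow> bool" where
  "bounded_delta_solution a b v\<^sub>0 V \<longleftrightarrow>
     bounded ((\<lambda>(y, t). V y t) ` (UNIV \<times> {0..})) \<and>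
     continuous_on (UNIV \<times> {0..}) (\<lambda>(y, t). V y t) \<and>
     (\<forall>y. V y 0 = v\<^sub>0 y) \<and>
     (\<forall>y t. y \<noteq> 0 \<longrightarrow> t > 0 \<longrightarrow>
        (\<lambda>s. V y s) differentiable (at t) \<and>
        (\<lambda>x. V x t) differentiable (at y) \<and>
        deriv (\<lambda>x. V x t) differentiable (at y) \<and>
        deriv (\<lambda>s. V y s) t = deriv (deriv (\<lambda>x. V x t)) y - a\<^sup>2 * (V y t - 1)) \<and>
     (\<forall>t>0. \<exists>p q.
        (deriv (\<lambda>x. V x t) \<longlongrightarrow> p) (at_right 0) \<and>
        (deriv (\<lambda>x. V x t) \<longlongrightarrow> q) (at_left 0) \<and>
        p - q = 2 * b * V 0 t)"

end

theory Submission
  imports Defs "HOL-Probability.Distributions" "HOL-Real_Asymp.Real_Asymp"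
begin

text \<open>
  The even part of \<open>V\<close> solves a Robin problem on the half line, whose bounded solution is unique
  by a maximum principle and explicit: \<open>V(y,t) = 1 - c e\<^sup>-\<^sup>a\<^sup>y - \<eta> q(y,t)\<close> for \<open>y \<ge> 0\<close>, with
  \<open>\<eta> = b(1 - c) - ac\<close> and \<open>q\<close> a combination of complementary error functions.  Put
  \<open>r\<^sub>k(t) = e\<^bsup>-a\<^sup>2t\<^esup> (1/\<surd>(\<pi>t) - k e\<^bsup>k\<^sup>2t\<^esup> erfc(k\<surd>t))\<close>, whose Laplace transform is \<open>1/(\<surd>(\<lambda> + a\<^sup>2) + k)\<close>.
  Then \<open>\<xi>' = -\<eta> r\<^sub>b\<close> and \<open>m\<^sub>a = 2 r\<^sub>a\<close>, so the claim becomes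
  \<open>r\<^sub>a * r\<^sub>b = 1 - (a + b) q(0,t)\<close>.  In Laplace variables this is
  \<open>1/((\<surd>\<mu> + a)(\<surd>\<mu> + b)) = 1/\<lambda> - (a + b)/(\<lambda>(\<surd>\<mu> + b))\<close> with \<open>\<mu> = \<lambda> + a\<^sup>2\<close>; here it is obtained without
  Laplace transforms, from a linear differential equation for the convolution, which the
  substitution \<open>s = t sin\<^sup>2 \<theta>\<close> turns into an integral with a smooth integrand.
\<close>

section \<open>The complementary error function\<close>

text \<open>The interval integral is signed, so the formula also covers negative arguments, which
  occur in \<open>heat_erfc (- a)\<close>.\<close>

definition erfc :: "real \<Rightarrow> real" where
  "erfc x = 1 - 2 / sqrt pi * (LBINT s=0..x. exp (- s\<^sup>2))"

lemma erfc_0: "erfc 0 = 1"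
  by (simp add: erfc_def zero_ereal_def)

lemma DERIV_erfc_at: "(erfc has_real_derivative - 2 / sqrt pi * exp (- x\<^sup>2)) (at x)"
proof -
  \<comment> \<open>The extra 1 puts \<open>x\<close> in the interior of \<open>{-l..l}\<close>,
    where the derivative within the interval is a full derivative.\<close>
  define l where "l = \<bar>x\<bar> + 1"
  have "((\<lambda>u. LBINT s=0..u. exp (- s\<^sup>2)) has_vector_derivative exp (- x\<^sup>2)) (at x within {-l..l})"
    using interval_integral_FTC2[of "-l" 0 l "\<lambda>s. exp (- s\<^sup>2)" x]
    by (force simp: l_def zero_ereal_def intro!: continuous_intros)
  moreover have "at x within {-l..l} = at x"
    by (rule at_within_interior) (auto simp: l_def)
  ultimately have "((\<lambda>u. LBINT s=0..u. exp (- s\<^sup>2)) has_real_derivative exp (- x\<^sup>2)) (at x)"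
    by (simp add: has_real_derivative_iff_has_vector_derivative)
  from DERIV_diff[OF DERIV_const[of 1] DERIV_cmult[OF this, of "2 / sqrt pi"]] show ?thesis
    unfolding erfc_def[abs_def] by simp
qed

lemmas DERIV_erfc [derivative_intros] = DERIV_chain2[OF DERIV_erfc_at]

lemma continuous_on_erfc [continuous_intros]:
  "continuous_on S f \<Longrightarrow> continuous_on S (\<lambda>x. erfc (f x))"
  by (rule continuous_on_compose2[of UNIV erfc])
     (auto intro!: DERIV_continuous_on DERIV_subset[OF DERIV_erfc_at])

lemma isCont_erfc: "isCont erfc x"
  by (rule DERIV_isCont[OF DERIV_erfc_at])

lemma erfc_minus: "erfc (- x) = 2 - erfc x"
proof -
  have "((\<lambda>x. erfc (- x) + erfc x) has_real_derivative 0) (at x)" for x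
    by (auto intro!: derivative_eq_intros)
  then have "erfc (- x) + erfc x = erfc (- 0) + erfc 0"
    using DERIV_isconst_all[of "\<lambda>x. erfc (- x) + erfc x" x 0] by blast
  then show ?thesis by (simp add: erfc_0)
qed

text \<open>The Gaussian integral over the half line is sqrt pi / 2, and the factor 2 / sqrt pi
  normalises it to 1.\<close>

lemma erfc_tendsto_0: "(erfc \<longlongrightarrow> 0) at_top"
proof -
  let ?f = "\<lambda>x::real. indicator {0..} x *\<^sub>R exp (- x\<^sup>2)"
  have "((\<lambda>y. LINT x|lborel. indicator {..y} x *\<^sub>R ?f x) \<longlongrightarrow> sqrt pi / 2) at_top"
    using tendsto_integral_at_top[of lborel ?f, OF _ integrable.intros[OF gaussian_moment_0]]
    unfolding has_bochner_integral_integral_eq[OF gaussian_moment_0] by simp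
  moreover have "eventually (\<lambda>y. (LINT x|lborel. indicator {..y} x *\<^sub>R ?f x)
      = (LBINT s=0..y. exp (- s\<^sup>2))) at_top"
    using eventually_ge_at_top[of 0]
  proof eventually_elim
    case (elim y)
    have "(LBINT s=ereal 0..ereal y. exp (- s\<^sup>2)) = (LBINT s:{0..y}. exp (- s\<^sup>2))"
      by (rule interval_integral_Icc) (use elim in auto)
    also have "\<dots> = (LINT x|lborel. indicator {..y} x *\<^sub>R ?f x)"
      unfolding set_lebesgue_integral_def
      by (intro Bochner_Integration.integral_cong) (auto simp: indicator_def)
    finally show ?case by (simp add: zero_ereal_def)
  qed
  ultimately have "((\<lambda>y. LBINT s=0..ereal y. exp (- s\<^sup>2)) \<longlongrightarrow> sqrt pi / 2) at_top"
    by (rule Lim_transform_eventually)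
  then have "((\<lambda>y. 1 - 2 / sqrt pi * (LBINT s=0..ereal y. exp (- s\<^sup>2))) \<longlongrightarrow> 1 - 2 / sqrt pi * (sqrt pi / 2)) at_top"
    by (intro tendsto_intros)
  then show ?thesis unfolding erfc_def[abs_def] by simp
qed

text \<open>A nonincreasing function stays above its limit, so sign claims reduce to a derivative
  and a limit at infinity.\<close>

lemma decreasing_tendsto_0_nonneg:
  fixes f f' :: "real \<Rightarrow> real"
  assumes "\<And>x. x > 0 \<Longrightarrow> (f has_real_derivative f' x) (at x)" "\<And>x. x > 0 \<Longrightarrow> f' x \<le> 0"
    and "(f \<longlongrightarrow> 0) at_top" "x > 0"
  shows "f x \<ge> 0"
proof (rule tendsto_upperbound[OF assms(3)])
  have "f y \<le> f x" if "y \<ge> x" for y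
    using assms(1,2,4) by (intro DERIV_nonpos_imp_nonincreasing[OF that])
      (meson order.strict_trans2)
  then show "eventually (\<lambda>y. f y \<le> f x) at_top"
    by (rule eventually_mono[OF eventually_ge_at_top[of x]])
qed auto

lemma decreasing_tendsto_0_pos:
  fixes f f' :: "real \<Rightarrow> real"
  assumes "\<And>x. x > 0 \<Longrightarrow> (f has_real_derivative f' x) (at x)" "\<And>x. x > 0 \<Longrightarrow> f' x < 0"
    and "(f \<longlongrightarrow> 0) at_top" "x > 0"
  shows "f x > 0"
proof -
  have "f (x + 1) \<ge> 0"
    using assms by (intro decreasing_tendsto_0_nonneg[of f f']) (auto intro: less_imp_le)
  moreover have "f (x + 1) < f x"
    using assms(1,2,4) by (intro DERIV_neg_imp_decreasing[of x "x + 1" f])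
      (auto, meson order.strict_trans2)
  ultimately show ?thesis by simp
qed

lemma erfc_antimono: "x \<le> y \<Longrightarrow> erfc y \<le> erfc x"
  by (erule DERIV_nonpos_imp_nonincreasing) (auto intro!: exI DERIV_erfc_at)

lemma erfc_nonneg: "erfc x \<ge> 0"
proof -
  have "erfc (max x 1) \<ge> 0"
    by (rule decreasing_tendsto_0_nonneg[OF DERIV_erfc_at _ erfc_tendsto_0]) auto
  then show ?thesis using erfc_antimono[of x "max x 1"] by simp
qed

lemma erfc_le_2: "erfc x \<le> 2"
  using erfc_nonneg[of "- x"] by (simp add: erfc_minus)

text \<open>Mills' inequality: after division by x, the gap between the two sides has a negative
  derivative and tends to 0 at infinity. It later controls the growing exponential in
  \<open>heat_erfc\<close>.\<close>

lemma erfc_mills: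
  assumes "x \<ge> 0" shows "x * erfc x \<le> exp (- x\<^sup>2) / sqrt pi"
proof (cases "x = 0")
  case False
  let ?f = "\<lambda>x. exp (- x\<^sup>2) / (x * sqrt pi) - erfc x"
  have "?f x \<ge> 0"
  proof (rule decreasing_tendsto_0_nonneg[of ?f "\<lambda>x. - exp (- x\<^sup>2) / (x\<^sup>2 * sqrt pi)"])
    fix x :: real assume "x > 0"
    then have "((\<lambda>x. exp (- x\<^sup>2) / x) has_real_derivative - 2 * exp (- x\<^sup>2) - exp (- x\<^sup>2) / x\<^sup>2) (at x)"
      by (auto intro!: derivative_eq_intros simp: field_simps power2_eq_square)
    from DERIV_diff[OF DERIV_cdivide[OF this, of "sqrt pi"] DERIV_erfc_at[of x]]
    show "(?f has_real_derivative - exp (- x\<^sup>2) / (x\<^sup>2 * sqrt pi)) (at x)"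
      by (simp add: field_simps)
  next
    have "((\<lambda>x. exp (- x\<^sup>2) / (x * sqrt pi)) \<longlongrightarrow> 0) at_top"
      by real_asymp
    from tendsto_diff[OF this erfc_tendsto_0] show "(?f \<longlongrightarrow> 0) at_top" by simp
  qed (use False assms in auto)
  then show ?thesis using False assms by (simp add: field_simps)
qed simp

section \<open>The resolvent of the Abel kernel\<close>

text \<open>This is the scaled complementary error function erfcx at the point k x.\<close>

definition scaled_erfc :: "real \<Rightarrow> real \<Rightarrow> real" where
  "scaled_erfc k x = exp (k\<^sup>2 * x\<^sup>2) * erfc (k * x)"

text \<open>\<open>resolvent k (\<surd>t) / \<surd>t\<close> has Laplace transform \<open>1/(\<surd>\<mu> + k)\<close>; in the variable \<open>x = \<surd>t\<close> the
  singularity at \<open>0\<close> disappears.\<close>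

definition resolvent :: "real \<Rightarrow> real \<Rightarrow> real" where
  "resolvent k x = 1 / sqrt pi - k * x * scaled_erfc k x"

lemma scaled_erfc_0 [simp]: "scaled_erfc k 0 = 1"
  by (simp add: scaled_erfc_def erfc_0)

lemma resolvent_0 [simp]: "resolvent k 0 = 1 / sqrt pi"
  by (simp add: resolvent_def)

text \<open>With the next lemma: \<open>scaled_erfc\<close> and \<open>resolvent\<close> satisfy a
  closed linear system, the source of the differential equations for the integrals below.\<close>

lemma DERIV_scaled_erfc_at: "(scaled_erfc k has_real_derivative - 2 * k * resolvent k x) (at x)"
  unfolding scaled_erfc_def[abs_def] resolvent_def
  by (auto intro!: derivative_eq_intros simp: algebra_simps power2_eq_square mult_exp_exp)

lemma DERIV_resolvent_at:
  "(resolvent k has_real_derivative - k * scaled_erfc k x + 2 * k\<^sup>2 * x * resolvent k x) (at x)"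
  unfolding resolvent_def[abs_def]
  by (auto intro!: derivative_eq_intros DERIV_chain2[OF DERIV_scaled_erfc_at]
    simp: resolvent_def algebra_simps power2_eq_square)

lemmas DERIV_scaled_erfc [derivative_intros] = DERIV_chain2[OF DERIV_scaled_erfc_at]
lemmas DERIV_resolvent [derivative_intros] = DERIV_chain2[OF DERIV_resolvent_at]

lemma continuous_on_scaled_erfc [continuous_intros]:
  "continuous_on S f \<Longrightarrow> continuous_on S (\<lambda>x. scaled_erfc k (f x))"
  unfolding scaled_erfc_def by (intro continuous_intros)

lemma continuous_on_resolvent [continuous_intros]:
  "continuous_on S f \<Longrightarrow> continuous_on S (\<lambda>x. resolvent k (f x))"
  unfolding resolvent_def by (intro continuous_intros)

section \<open>Differential equations for trigonometric integrals of resolvents\<close>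

lemma DERIV_integral_parameter:
  fixes f f' :: "real \<Rightarrow> real \<Rightarrow> real"
  assumes "\<And>x \<theta>. ((\<lambda>x. f x \<theta>) has_real_derivative f' x \<theta>) (at x)"
    and "\<And>x. continuous_on {\<alpha>..\<beta>} (f x)"
    and "continuous_on (UNIV \<times> {\<alpha>..\<beta>}) (\<lambda>(x, \<theta>). f' x \<theta>)"
  shows "((\<lambda>x. integral {\<alpha>..\<beta>} (f x)) has_real_derivative integral {\<alpha>..\<beta>} (f' x)) (at x)"
  using leibniz_rule_field_derivative[of UNIV \<alpha> \<beta> f f' x] assms
  by (auto intro: integrable_continuous_interval)

lemma has_integral_deriv:
  fixes f f' :: "real \<Rightarrow> real"
  assumes "\<alpha> \<le> \<beta>" "\<And>x. (f has_real_derivative f' x) (at x)"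
  shows "(f' has_integral (f \<beta> - f \<alpha>)) {\<alpha>..\<beta>}"
  by (rule fundamental_theorem_of_calculus)
    (use assms in \<open>auto simp: has_real_derivative_iff_has_vector_derivative[symmetric] intro: DERIV_subset\<close>)

text \<open>The case \<open>a = 0\<close> of the convolution identity.\<close>

lemma integral_resolvent_sin:
  "integral {0..pi / 2} (\<lambda>\<theta>. resolvent k (x * sin \<theta>)) = sqrt pi / 2 * scaled_erfc k x"
proof -
  define N where "N = (\<lambda>x. integral {0..pi / 2} (\<lambda>\<theta>. resolvent k (x * sin \<theta>)))"
  define N' where "N' = (\<lambda>x. integral {0..pi / 2} (\<lambda>\<theta>. sin \<theta> *
      (- k * scaled_erfc k (x * sin \<theta>) + 2 * k\<^sup>2 * (x * sin \<theta>) * resolvent k (x * sin \<theta>))))"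
  have N': "(N has_real_derivative N' x) (at x)" for x
    unfolding N_def N'_def
    by (rule DERIV_integral_parameter)
      (auto intro!: derivative_eq_intros continuous_intros simp: case_prod_unfold)
  have eq: "N' x = - k + 2 * k\<^sup>2 * x * N x" for x
  proof -
    \<comment> \<open>\<open>?d\<close> is the derivative of cos \<theta> times
      \<open>scaled_erfc k (x * sin \<theta>)\<close>, with boundary values 0 and 1. Adding
      \<open>k * ?d\<close> to \<open>2 * k\<^sup>2 * x\<close> times the integrand of
      \<open>N\<close> gives the integrand of \<open>N'\<close>, by 1 - cos^2 = sin^2.\<close>
    let ?d = "\<lambda>\<theta>. - sin \<theta> * scaled_erfc k (x * sin \<theta>) + cos \<theta> * (- 2 * k * resolvent k (x * sin \<theta>) * (x * cos \<theta>))"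
    have "(?d has_integral (cos (pi / 2) * scaled_erfc k (x * sin (pi / 2)) - cos 0 * scaled_erfc k (x * sin 0))) {0..pi / 2}"
      by (rule has_integral_deriv) (auto intro!: derivative_eq_intros)
    then have d: "(?d has_integral - 1) {0..pi / 2}" by simp
    have "((\<lambda>\<theta>. resolvent k (x * sin \<theta>)) has_integral N x) {0..pi / 2}"
      unfolding N_def by (intro integrable_integral integrable_continuous_interval continuous_intros)
    from has_integral_add[OF has_integral_mult_right[OF d, of k] has_integral_mult_right[OF this, of "2 * k\<^sup>2 * x"]]
    have "((\<lambda>\<theta>. k * ?d \<theta> + 2 * k\<^sup>2 * x * resolvent k (x * sin \<theta>)) has_integral - k + 2 * k\<^sup>2 * x * N x) {0..pi / 2}"
      by simp
    also have "(\<lambda>\<theta>. k * ?d \<theta> + 2 * k\<^sup>2 * x * resolvent k (x * sin \<theta>)) =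
      (\<lambda>\<theta>. sin \<theta> * (- k * scaled_erfc k (x * sin \<theta>) + 2 * k\<^sup>2 * (x * sin \<theta>) * resolvent k (x * sin \<theta>)))"
    proof
      fix \<theta> :: real
      define r m where "r = resolvent k (x * sin \<theta>)" and "m = scaled_erfc k (x * sin \<theta>)"
      have "k * ?d \<theta> + 2 * k\<^sup>2 * x * resolvent k (x * sin \<theta>) = - k * sin \<theta> * m + 2 * k\<^sup>2 * x * r * (1 - (cos \<theta>)\<^sup>2)"
        unfolding r_def[symmetric] m_def[symmetric] by (simp add: algebra_simps power2_eq_square)
      also have "1 - (cos \<theta>)\<^sup>2 = (sin \<theta>)\<^sup>2"
        by (simp add: sin_squared_eq)
      finally show "k * ?d \<theta> + 2 * k\<^sup>2 * x * resolvent k (x * sin \<theta>) =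
          sin \<theta> * (- k * scaled_erfc k (x * sin \<theta>) + 2 * k\<^sup>2 * (x * sin \<theta>) * resolvent k (x * sin \<theta>))"
        unfolding r_def[symmetric] m_def[symmetric] by (simp add: algebra_simps power2_eq_square)
    qed
    finally show ?thesis unfolding N'_def by (simp add: integral_unique)
  qed
  \<comment> \<open>Both terms of the difference solve y' = 2 k^2 x y - k and equal sqrt pi / 2 at
    0; the exponential is the integrating factor.\<close>
  let ?h = "\<lambda>x. exp (- k\<^sup>2 * x\<^sup>2) * (N x - sqrt pi / 2 * scaled_erfc k x)"
  have "(?h has_real_derivative 0) (at x)" for x
    by (auto intro!: derivative_eq_intros N' simp: eq resolvent_def)
      (simp add: algebra_simps power2_eq_square)
  then have "?h x = ?h 0"
    using DERIV_isconst_all[of ?h x 0] by blast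
  also have "\<dots> = 0"
    by (simp add: N_def field_simps)
  finally show ?thesis by (simp add: N_def)
qed

text \<open>At x = sqrt t, \<open>Y a b\<close> is the convolution of r_a and r_b up to the factor 2
  exp(-a^2 t). The integrating factor exp(-a^2 x^2) of this equation is that same exponential, and
  the source involves only the resolvent of \<open>b\<close>, to which \<xi>' is
  proportional.\<close>

lemma integral_resolvent_cos_sin_ode:
  defines "Y \<equiv> (\<lambda>a b x. integral {0..pi / 2} (\<lambda>\<theta>. resolvent a (x * cos \<theta>) * resolvent b (x * sin \<theta>)))"
  shows "(Y a b has_real_derivative 2 * a\<^sup>2 * x * Y a b x - (a + b) * resolvent b x) (at x)"
proof -
  let ?R' = "\<lambda>k x. - k * scaled_erfc k x + 2 * k\<^sup>2 * x * resolvent k x"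
  let ?y' = "\<lambda>x \<theta>. cos \<theta> * ?R' a (x * cos \<theta>) * resolvent b (x * sin \<theta>)
    + resolvent a (x * cos \<theta>) * (sin \<theta> * ?R' b (x * sin \<theta>))"
  have deriv: "(Y a b has_real_derivative integral {0..pi / 2} (?y' x)) (at x)"
    unfolding Y_def
    by (rule DERIV_integral_parameter)
      (auto intro!: derivative_eq_intros continuous_intros simp: case_prod_unfold)
  \<comment> \<open>Up to the exact derivative of \<open>?F\<close>, the integrand \<open>?y' x\<close> reduces to \<open>2 a\<^sup>2 x\<close> times that
    of \<open>Y\<close> and a term without \<open>a\<close>, which the previous lemma integrates.\<close>
  let ?F = "\<lambda>\<theta>. a * sin \<theta> * scaled_erfc a (x * cos \<theta>) * resolvent b (x * sin \<theta>)"
  let ?d = "\<lambda>\<theta>. a * cos \<theta> * scaled_erfc a (x * cos \<theta>) * resolvent b (x * sin \<theta>)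
    + a * sin \<theta> * (2 * a * resolvent a (x * cos \<theta>) * (x * sin \<theta>)) * resolvent b (x * sin \<theta>)
    + a * sin \<theta> * scaled_erfc a (x * cos \<theta>) * (?R' b (x * sin \<theta>) * (x * cos \<theta>))"
  have "(?d has_integral (?F (pi / 2) - ?F 0)) {0..pi / 2}"
    by (rule has_integral_deriv) (auto intro!: derivative_eq_intros simp: algebra_simps)
  then have d: "(?d has_integral a * resolvent b x) {0..pi / 2}" by simp
  have Y: "((\<lambda>\<theta>. resolvent a (x * cos \<theta>) * resolvent b (x * sin \<theta>)) has_integral Y a b x) {0..pi / 2}"
    unfolding Y_def by (intro integrable_integral integrable_continuous_interval continuous_intros)
  \<comment> \<open>Differentiating both sides of \<open>integral_resolvent_sin\<close> in
    \<open>x\<close> evaluates the remaining integral.\<close>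
  have "((\<lambda>x. integral {0..pi / 2} (\<lambda>\<theta>. resolvent b (x * sin \<theta>))) has_real_derivative
      integral {0..pi / 2} (\<lambda>\<theta>. sin \<theta> * ?R' b (x * sin \<theta>))) (at x)"
    by (rule DERIV_integral_parameter)
      (auto intro!: derivative_eq_intros continuous_intros simp: case_prod_unfold)
  moreover have "((\<lambda>x. sqrt pi / 2 * scaled_erfc b x) has_real_derivative - (sqrt pi * b * resolvent b x)) (at x)"
    by (auto intro!: derivative_eq_intros)
  ultimately have val: "integral {0..pi / 2} (\<lambda>\<theta>. sin \<theta> * ?R' b (x * sin \<theta>)) = - (sqrt pi * b * resolvent b x)"
    unfolding integral_resolvent_sin by (rule DERIV_unique)
  have "(\<lambda>\<theta>. sin \<theta> * ?R' b (x * sin \<theta>)) integrable_on {0..pi / 2}"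
    by (intro integrable_continuous_interval continuous_intros)
  from integrable_integral[OF this] have b: "((\<lambda>\<theta>. sin \<theta> * ?R' b (x * sin \<theta>)) has_integral - (sqrt pi * b * resolvent b x)) {0..pi / 2}"
    unfolding val .
  have eq: "?y' x = (\<lambda>\<theta>. 2 * a\<^sup>2 * x * (resolvent a (x * cos \<theta>) * resolvent b (x * sin \<theta>)) - ?d \<theta>
      + 1 / sqrt pi * (sin \<theta> * ?R' b (x * sin \<theta>)))"
  proof
    fix \<theta> :: real
    define r m r' s c p where "r = resolvent b (x * sin \<theta>)" and "m = scaled_erfc a (x * cos \<theta>)"
      and "r' = ?R' b (x * sin \<theta>)" and "s = sin \<theta>" and "c = cos \<theta>" and "p = 1 / sqrt pi"
    have R: "resolvent a (x * cos \<theta>) = p - a * (x * c) * m"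
      by (simp add: resolvent_def m_def p_def c_def)
    have *: "c * c + s * s - 1 = 0"
      using sin_squared_eq[of \<theta>] by (simp add: s_def c_def power2_eq_square)
    \<comment> \<open>Once \<open>resolvent a\<close> is expanded and the other special functions
      are treated as unknowns, the two sides differ by a multiple of cos^2 + sin^2 - 1.\<close>
    have "c * (- a * m + 2 * a\<^sup>2 * (x * c) * (p - a * (x * c) * m)) * r + (p - a * (x * c) * m) * (s * r')
      = 2 * a\<^sup>2 * x * ((p - a * (x * c) * m) * r) - (a * c * m * r + a * s * (2 * a * (p - a * (x * c) * m) * (x * s)) * r
          + a * s * m * (r' * (x * c))) + p * (s * r') + 2 * a\<^sup>2 * x * (p - a * (x * c) * m) * r * (c * c + s * s - 1)"
      by (simp add: algebra_simps power2_eq_square)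
    then show "?y' x \<theta> = 2 * a\<^sup>2 * x * (resolvent a (x * cos \<theta>) * resolvent b (x * sin \<theta>)) - ?d \<theta>
      + 1 / sqrt pi * (sin \<theta> * ?R' b (x * sin \<theta>))"
      unfolding r'_def[symmetric] R
      unfolding r_def[symmetric] m_def[symmetric]
      unfolding s_def[symmetric] c_def[symmetric] p_def[symmetric]
      by (simp only: * mult_zero_right add_0_right)
  qed
  have "(?y' x has_integral 2 * a\<^sup>2 * x * Y a b x - a * resolvent b x
      + 1 / sqrt pi * - (sqrt pi * b * resolvent b x)) {0..pi / 2}"
    unfolding eq by (rule has_integral_add[OF has_integral_diff[OF has_integral_mult_right[OF Y] d]
      has_integral_mult_right[OF b]])
  then have "integral {0..pi / 2} (?y' x) = 2 * a\<^sup>2 * x * Y a b x - (a + b) * resolvent b x"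
    by (simp add: integral_unique algebra_simps)
  with deriv show ?thesis by simp
qed

section \<open>The explicit solution of the Robin problem\<close>

text \<open>Twice the Gauss kernel, that is, the Neumann heat kernel of the half line with source at
  0.\<close>

definition heat_kernel :: "real \<Rightarrow> real \<Rightarrow> real" where
  "heat_kernel y t = exp (- y\<^sup>2 / (4 * t)) / (sqrt pi * sqrt t)"

text \<open>The solution of u_t = u_yy with Laplace transform exp(-y sqrt \<lambda>) / (sqrt
  \<lambda> (sqrt \<lambda> + k)) for y \<ge> 0; it satisfies u_y = k u -
  \<open>heat_kernel\<close>.\<close>

definition heat_erfc :: "real \<Rightarrow> real \<Rightarrow> real \<Rightarrow> real" where
  "heat_erfc k y t = exp (k * y + k\<^sup>2 * t) * erfc (k * sqrt t + y / (2 * sqrt t))"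

text \<open>The derivative of \<open>heat_erfc\<close> in \<open>k\<close>. It serves both as the
  additional solution for a = b and in the mean value estimate between different values of
  \<open>k\<close>.\<close>

definition heat_erfc_dk :: "real \<Rightarrow> real \<Rightarrow> real \<Rightarrow> real" where
  "heat_erfc_dk k y t = (y + 2 * k * t) * heat_erfc k y t - 2 * t * heat_kernel y t"

text \<open>Completing the square: whenever erfc is differentiated, the resulting Gaussian combines
  with the prefactor into a multiple of \<open>heat_kernel\<close>.\<close>

lemma exp_heat_erfc:
  assumes "t > 0"
  shows "exp (k * y + k\<^sup>2 * t) * exp (- (k * sqrt t + y / (2 * sqrt t))\<^sup>2) = exp (- y\<^sup>2 / (4 * t))"
proof -
  define s where "s = sqrt t"
  have s: "s > 0" "t = s\<^sup>2" using assms by (auto simp: s_def)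
  have "k * y + k\<^sup>2 * t - (k * s + y / (2 * s))\<^sup>2 = - y\<^sup>2 / (4 * t)"
    using s(1) unfolding s(2) by (simp add: field_simps power2_eq_square)
  then show ?thesis unfolding s_def by (simp add: exp_add[symmetric] algebra_simps)
qed

lemma DERIV_heat_kernel_y:
  "t > 0 \<Longrightarrow> ((\<lambda>y. heat_kernel y t) has_real_derivative - y / (2 * t) * heat_kernel y t) (at y)"
  unfolding heat_kernel_def by (auto intro!: derivative_eq_intros simp: field_simps)

lemma DERIV_inverse_sqrt:
  assumes "t > 0"
  shows "((\<lambda>t. 1 / sqrt t) has_real_derivative - 1 / (2 * t * sqrt t)) (at t)"
  using assms by (auto intro!: derivative_eq_intros simp: divide_simps)

lemma DERIV_heat_kernel_t:
  assumes "t > 0"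
  shows "((\<lambda>t. heat_kernel y t) has_real_derivative (y\<^sup>2 / (4 * t\<^sup>2) - 1 / (2 * t)) * heat_kernel y t) (at t)"
proof -
  have "((\<lambda>t. exp (- y\<^sup>2 / (4 * t))) has_real_derivative exp (- y\<^sup>2 / (4 * t)) * (y\<^sup>2 / (4 * t\<^sup>2))) (at t)"
    using assms by (auto intro!: derivative_eq_intros simp: divide_simps power2_eq_square)
  from DERIV_cdivide[OF DERIV_mult[OF this DERIV_inverse_sqrt[OF assms]], of "sqrt pi"]
  have "((\<lambda>t. heat_kernel y t) has_real_derivative
      (exp (- y\<^sup>2 / (4 * t)) * (y\<^sup>2 / (4 * t\<^sup>2)) * (1 / sqrt t) + - 1 / (2 * t * sqrt t) * exp (- y\<^sup>2 / (4 * t))) / sqrt pi) (at t)"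
    unfolding heat_kernel_def by (simp add: mult.commute)
  then show ?thesis
    by (rule DERIV_cong) (simp add: heat_kernel_def diff_divide_distrib algebra_simps)
qed

lemma DERIV_heat_erfc_y:
  assumes "t > 0"
  shows "((\<lambda>y. heat_erfc k y t) has_real_derivative k * heat_erfc k y t - heat_kernel y t) (at y)"
proof -
  have "((\<lambda>y. k * sqrt t + y / (2 * sqrt t)) has_real_derivative 0 + 1 / (2 * sqrt t)) (at y)"
    by (intro DERIV_add DERIV_const DERIV_cdivide DERIV_ident)
  note erfc = DERIV_erfc[OF this]
  have "((\<lambda>y. exp (k * y + k\<^sup>2 * t)) has_real_derivative exp (k * y + k\<^sup>2 * t) * k) (at y)"
    by (auto intro!: derivative_eq_intros)
  from DERIV_mult[OF this erfc]
  have "((\<lambda>y. heat_erfc k y t) has_real_derivative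
      k * heat_erfc k y t + (exp (k * y + k\<^sup>2 * t) * exp (- (k * sqrt t + y / (2 * sqrt t))\<^sup>2)) * (- 2 / sqrt pi * (1 / (2 * sqrt t)))) (at y)"
    unfolding heat_erfc_def by (rule DERIV_cong) (simp add: algebra_simps)
  then show ?thesis
    unfolding exp_heat_erfc[OF assms] heat_kernel_def by simp
qed

lemma DERIV_heat_erfc_t:
  assumes "t > 0"
  shows "((\<lambda>t. heat_erfc k y t) has_real_derivative
    k\<^sup>2 * heat_erfc k y t - k * heat_kernel y t + y / (2 * t) * heat_kernel y t) (at t)"
proof -
  have "((\<lambda>t. k * sqrt t + y / 2 * (1 / sqrt t)) has_real_derivative
      k * (inverse (sqrt t) / 2) + y / 2 * (- 1 / (2 * t * sqrt t))) (at t)"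
    by (intro DERIV_add DERIV_cmult DERIV_inverse_sqrt DERIV_real_sqrt assms)
  then have "((\<lambda>t. k * sqrt t + y / (2 * sqrt t)) has_real_derivative
      k * (inverse (sqrt t) / 2) + y / 2 * (- 1 / (2 * t * sqrt t))) (at t)"
    by simp
  note erfc = DERIV_erfc[OF this]
  have "((\<lambda>t. exp (k * y + k\<^sup>2 * t)) has_real_derivative exp (k * y + k\<^sup>2 * t) * k\<^sup>2) (at t)"
    by (auto intro!: derivative_eq_intros)
  from DERIV_mult[OF this erfc]
  have "((\<lambda>t. heat_erfc k y t) has_real_derivative
      k\<^sup>2 * heat_erfc k y t + (exp (k * y + k\<^sup>2 * t) * exp (- (k * sqrt t + y / (2 * sqrt t))\<^sup>2)) *
       (- 2 / sqrt pi * (k * (inverse (sqrt t) / 2) + y / 2 * (- 1 / (2 * t * sqrt t))))) (at t)"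
    unfolding heat_erfc_def by (rule DERIV_cong) (simp add: algebra_simps diff_divide_distrib)
  then show ?thesis
    unfolding exp_heat_erfc[OF assms]
    by (rule DERIV_cong) (use assms in \<open>simp add: heat_kernel_def field_simps\<close>)
qed

lemma DERIV_heat_erfc_k:
  assumes "t > 0"
  shows "((\<lambda>k. heat_erfc k y t) has_real_derivative heat_erfc_dk k y t) (at k)"
proof -
  have "((\<lambda>k. heat_erfc k y t) has_real_derivative
      (y + 2 * k * t) * heat_erfc k y t + (exp (k * y + k\<^sup>2 * t) * exp (- (k * sqrt t + y / (2 * sqrt t))\<^sup>2)) *
       (- 2 / sqrt pi * sqrt t)) (at k)"
    unfolding heat_erfc_def using assms
    by (auto intro!: derivative_eq_intros)
  moreover have "t / sqrt t = sqrt t" using assms by (simp add: real_div_sqrt)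
  then have "2 * t * heat_kernel y t = exp (- y\<^sup>2 / (4 * t)) * (2 / sqrt pi * sqrt t)"
    using assms by (simp add: heat_kernel_def field_simps)
  ultimately show ?thesis
    unfolding exp_heat_erfc[OF assms] heat_erfc_dk_def by simp
qed

text \<open>This formula and the next are what differentiating the formulas for
  \<open>heat_erfc\<close> in \<open>k\<close> predicts.\<close>

lemma DERIV_heat_erfc_dk_y:
  assumes "t > 0"
  shows "((\<lambda>y. heat_erfc_dk k y t) has_real_derivative heat_erfc k y t + k * heat_erfc_dk k y t) (at y)"
  unfolding heat_erfc_dk_def using assms
  by (auto intro!: derivative_eq_intros DERIV_heat_erfc_y DERIV_heat_kernel_y simp: field_simps)

lemma DERIV_heat_erfc_dk_t:
  assumes "t > 0"
  shows "((\<lambda>t. heat_erfc_dk k y t) has_real_derivative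
    2 * k * heat_erfc k y t + k\<^sup>2 * heat_erfc_dk k y t - heat_kernel y t) (at t)"
  unfolding heat_erfc_dk_def using assms
  by (auto intro!: derivative_eq_intros DERIV_heat_erfc_t DERIV_heat_kernel_t simp: field_simps power2_eq_square)

section \<open>Estimates for small t, uniform in y\<close>

lemma heat_erfc_nonneg: "heat_erfc k y t \<ge> 0"
  by (simp add: heat_erfc_def erfc_nonneg)

text \<open>With z the argument of erfc, the quantity is 2 sqrt t (z \<open>heat_erfc\<close> - sqrt
  t \<open>heat_kernel\<close>). For z \<ge> 0 Mills' inequality bounds the first product by the
  second; z < 0 forces k < 0 and |z| \<le> |k| sqrt t, where erfc \<le> 2 suffices.\<close>

lemma abs_heat_erfc_dk_le:
  assumes "t > 0" "y \<ge> 0"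
  shows "\<bar>heat_erfc_dk k y t\<bar> \<le> 2 * sqrt t * (1 / sqrt pi + 2 * \<bar>k\<bar> * sqrt t * exp (k\<^sup>2 * t))"
proof -
  define s z where "s = sqrt t" and "z = k * s + y / (2 * s)"
  have s: "s > 0" "t = s\<^sup>2" using assms by (auto simp: s_def)
  have E: "heat_erfc k y t = exp (k * y + k\<^sup>2 * t) * erfc z"
    by (simp add: heat_erfc_def s_def z_def)
  have K: "s * heat_kernel y t = exp (- y\<^sup>2 / (4 * t)) / sqrt pi"
    using s(1) by (simp add: heat_kernel_def s_def[symmetric])
  have D: "heat_erfc_dk k y t = 2 * s * (z * heat_erfc k y t - s * heat_kernel y t)"
    using s(1) unfolding heat_erfc_dk_def z_def s(2) by (simp add: field_simps power2_eq_square)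
  have K01: "0 \<le> s * heat_kernel y t" "s * heat_kernel y t \<le> 1 / sqrt pi"
    unfolding K using assms by (auto simp: divide_right_mono)
  have "\<bar>z * heat_erfc k y t - s * heat_kernel y t\<bar> \<le> 1 / sqrt pi + 2 * \<bar>k\<bar> * s * exp (k\<^sup>2 * t)"
  proof (cases "z \<ge> 0")
    case True
    have "z * heat_erfc k y t = exp (k * y + k\<^sup>2 * t) * (z * erfc z)"
      by (simp add: E)
    also have "\<dots> \<le> exp (k * y + k\<^sup>2 * t) * (exp (- z\<^sup>2) / sqrt pi)"
      by (intro mult_left_mono erfc_mills True) simp
    also have "\<dots> = s * heat_kernel y t"
      unfolding K using exp_heat_erfc[OF assms(1), of k y] by (simp add: z_def s_def)
    finally have "z * heat_erfc k y t \<le> s * heat_kernel y t" .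
    moreover have "z * heat_erfc k y t \<ge> 0"
      using True heat_erfc_nonneg by simp
    moreover have "2 * \<bar>k\<bar> * s * exp (k\<^sup>2 * t) \<ge> 0"
      using s by simp
    ultimately show ?thesis using K01 by linarith
  next
    case False
    have "y / (2 * s) \<ge> 0" using assms s by simp
    with False have "k * s < 0" unfolding z_def by linarith
    then have "k < 0" using s(1) by (simp add: mult_less_0_iff)
    then have "k * y \<le> 0" using assms by (simp add: mult_nonpos_nonneg)
    have "\<bar>z\<bar> \<le> \<bar>k\<bar> * s"
      using False \<open>y / (2 * s) \<ge> 0\<close> \<open>k < 0\<close> unfolding z_def by simp
    moreover have "heat_erfc k y t \<le> exp (k\<^sup>2 * t) * 2"
      unfolding E using \<open>k * y \<le> 0\<close> by (intro mult_mono erfc_le_2 erfc_nonneg) auto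
    ultimately have "\<bar>z\<bar> * heat_erfc k y t \<le> (\<bar>k\<bar> * s) * (exp (k\<^sup>2 * t) * 2)"
      using s(1) by (intro mult_mono heat_erfc_nonneg) auto
    moreover have "\<bar>z * heat_erfc k y t\<bar> = \<bar>z\<bar> * heat_erfc k y t"
      using heat_erfc_nonneg[of k y t] by (simp add: abs_mult)
    ultimately show ?thesis using K01 by (simp add: algebra_simps)
  qed
  then have "2 * s * \<bar>z * heat_erfc k y t - s * heat_kernel y t\<bar> \<le> 2 * s * (1 / sqrt pi + 2 * \<bar>k\<bar> * s * exp (k\<^sup>2 * t))"
    using s(1) by (intro mult_left_mono) auto
  then show ?thesis
    using s(1) unfolding D by (simp add: abs_mult s_def)
qed

text \<open>Mean value theorem in \<open>k\<close>. Each \<open>heat_erfc\<close> is discontinuous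
  at the corner (0,0), but the differences vanish there like sqrt t, uniformly in y \<ge> 0.\<close>

lemma abs_heat_erfc_diff_le:
  assumes "0 < t" "t \<le> T" "y \<ge> 0" "\<bar>k\<bar> \<le> \<kappa>"
  defines "c \<equiv> 2 * (1 / sqrt pi + 2 * \<kappa> * sqrt T * exp (\<kappa>\<^sup>2 * T))"
  shows "\<bar>heat_erfc_dk k y t\<bar> \<le> c * sqrt t"
    and "\<bar>heat_erfc k y t - heat_erfc 0 y t\<bar> \<le> c * sqrt t * \<kappa>"
proof -
  have *: "\<bar>heat_erfc_dk l y t\<bar> \<le> c * sqrt t" if "\<bar>l\<bar> \<le> \<kappa>" for l
  proof -
    have "l\<^sup>2 \<le> \<kappa>\<^sup>2" using that by (simp add: abs_le_square_iff[symmetric])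
    then have "\<bar>l\<bar> * sqrt t * exp (l\<^sup>2 * t) \<le> \<kappa> * sqrt T * exp (\<kappa>\<^sup>2 * T)"
      using assms that by (intro mult_mono) (auto intro!: mult_mono)
    then have le: "2 * sqrt t * (1 / sqrt pi + 2 * (\<bar>l\<bar> * sqrt t * exp (l\<^sup>2 * t)))
      \<le> 2 * sqrt t * (1 / sqrt pi + 2 * (\<kappa> * sqrt T * exp (\<kappa>\<^sup>2 * T)))"
      using assms by (intro mult_left_mono add_left_mono) auto
    have "\<bar>heat_erfc_dk l y t\<bar> \<le> 2 * sqrt t * (1 / sqrt pi + 2 * (\<bar>l\<bar> * sqrt t * exp (l\<^sup>2 * t)))"
      using abs_heat_erfc_dk_le[of t y l] assms by (simp add: mult.assoc)
    also note le
    also have "2 * sqrt t * (1 / sqrt pi + 2 * (\<kappa> * sqrt T * exp (\<kappa>\<^sup>2 * T))) = c * sqrt t"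
      by (simp add: c_def algebra_simps)
    finally show ?thesis .
  qed
  show "\<bar>heat_erfc_dk k y t\<bar> \<le> c * sqrt t" using * assms by blast
  have "norm (heat_erfc k y t - heat_erfc 0 y t) \<le> c * sqrt t * norm (k - 0)"
    by (rule field_differentiable_bound[where S = "{-\<kappa>..\<kappa>}" and f' = "\<lambda>l. heat_erfc_dk l y t"])
      (use assms * in \<open>auto intro!: DERIV_subset[OF DERIV_heat_erfc_k]\<close>)
  also have "\<dots> \<le> c * sqrt t * \<kappa>"
    using assms order_trans[OF abs_ge_zero *[OF assms(4)]] by (intro mult_left_mono) auto
  finally show "\<bar>heat_erfc k y t - heat_erfc 0 y t\<bar> \<le> c * sqrt t * \<kappa>" by simp
qed

text \<open>The third clause is the value of \<open>q\<^sub>t(0,t)\<close>, by the first one.\<close>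

definition robin_profile :: "real \<Rightarrow> real \<Rightarrow> (real \<Rightarrow> real \<Rightarrow> real) \<Rightarrow> (real \<Rightarrow> real \<Rightarrow> real) \<Rightarrow> (real \<Rightarrow> real \<Rightarrow> real) \<Rightarrow> bool" where
  "robin_profile a b q qy qyy \<longleftrightarrow>
    (\<forall>t>0. \<forall>y.
      ((\<lambda>s. q y s) has_real_derivative qyy y t - a\<^sup>2 * q y t) (at t) \<and>
      ((\<lambda>x. q x t) has_real_derivative qy y t) (at y) \<and>
      ((\<lambda>x. qy x t) has_real_derivative qyy y t) (at y)) \<and>
    (\<forall>t>0. qy 0 t = b * q 0 t - 1) \<and>
    (\<forall>t>0. qyy 0 t - a\<^sup>2 * q 0 t = exp (- a\<^sup>2 * t) * resolvent b (sqrt t) / sqrt t) \<and>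
    (\<forall>y. q y 0 = 0) \<and>
    continuous_on ({0..} \<times> {0..}) (\<lambda>(y, t). q y t) \<and>
    (\<forall>T. \<exists>M. \<forall>y\<ge>0. \<forall>t\<in>{0..T}. \<bar>q y t\<bar> \<le> M)"

lemma heat_kernel_at_0: "heat_kernel 0 t = 1 / (sqrt pi * sqrt t)"
  by (simp add: heat_kernel_def)

lemma heat_erfc_at_0: "t > 0 \<Longrightarrow> heat_erfc k 0 t = scaled_erfc k (sqrt t)"
  by (simp add: heat_erfc_def scaled_erfc_def)

text \<open>The coefficients come from the partial fractions of \<open>\<surd>\<mu> / ((\<surd>\<mu> - a)(\<surd>\<mu> + a)(\<surd>\<mu> + b))\<close>; for
  \<open>a = b\<close> the double root brings in the derivative of \<open>heat_erfc\<close> in \<open>k\<close>.  Their vanishing sum is what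
  makes the combination continuous at the corner \<open>(0,0)\<close>, where \<open>heat_erfc\<close> itself is not.\<close>

lemma robin_profile_combination:
  fixes a b A B C G :: real
  assumes ab: "a \<ge> 0" "b > 0"
    and C: "C = - A - B"
    and robin: "A * (a + b) = 1 / 2" "B * (a - b) + G = - 1 / 2" "G * (a - b) = 0"
    and flux: "a * A - a * B - b * C - G = 1" "C * (b\<^sup>2 - a\<^sup>2) = - b \<and> G = 0 \<or> a = b \<and> C = 0 \<and> 2 * a * G = - b"
  shows "\<exists>q qy qyy. robin_profile a b q qy qyy"
proof -
  \<comment> \<open>The initial value 0 is prescribed: at t = 0 the formula would divide by zero and
    return default values instead of limits.\<close>
  define q where "q = (\<lambda>y t. if t \<le> 0 then 0 else exp (- a\<^sup>2 * t) *
    (A * heat_erfc (- a) y t + B * heat_erfc a y t + C * heat_erfc b y t + G * heat_erfc_dk a y t))"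
  define qy where "qy = (\<lambda>y t. exp (- a\<^sup>2 * t) *
    (- a * A * heat_erfc (- a) y t + a * B * heat_erfc a y t + b * C * heat_erfc b y t
     + G * (heat_erfc a y t + a * heat_erfc_dk a y t)))"
  define qyy where "qyy = (\<lambda>y t. exp (- a\<^sup>2 * t) *
    (a * A * (a * heat_erfc (- a) y t + heat_kernel y t) + a * B * (a * heat_erfc a y t - heat_kernel y t)
     + b * C * (b * heat_erfc b y t - heat_kernel y t)
     + G * (2 * a * heat_erfc a y t - heat_kernel y t + a\<^sup>2 * heat_erfc_dk a y t)))"
  have q_pos: "q y t = exp (- a\<^sup>2 * t) *
    (A * heat_erfc (- a) y t + B * heat_erfc a y t + C * heat_erfc b y t + G * heat_erfc_dk a y t)" if "t > 0" for y t
    using that by (simp add: q_def)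
  have q_t: "((\<lambda>s. q y s) has_real_derivative qyy y t - a\<^sup>2 * q y t) (at t)" if t: "t > 0" for y t
  proof (rule has_field_derivative_transform_within_open)
    show "((\<lambda>t. exp (- a\<^sup>2 * t) *
      (A * heat_erfc (- a) y t + B * heat_erfc a y t + C * heat_erfc b y t + G * heat_erfc_dk a y t))
      has_real_derivative qyy y t - a\<^sup>2 * q y t) (at t)"
      unfolding qyy_def q_pos[OF t] using t
      by (auto intro!: derivative_eq_intros DERIV_heat_erfc_t DERIV_heat_erfc_dk_t simp: C)
        (simp add: algebra_simps power2_eq_square diff_divide_distrib)
    show "t \<in> {0<..}" using t by simp
  qed (auto simp: q_pos)
  have q_y: "((\<lambda>x. q x t) has_real_derivative qy y t) (at y)" if t: "t > 0" for y t
    unfolding qy_def q_pos[OF t] using t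
    by (auto intro!: derivative_eq_intros DERIV_heat_erfc_y DERIV_heat_erfc_dk_y simp: C)
      (simp add: algebra_simps power2_eq_square)
  have q_yy: "((\<lambda>x. qy x t) has_real_derivative qyy y t) (at y)" if t: "t > 0" for y t
    unfolding qy_def qyy_def using t
    by (auto intro!: derivative_eq_intros DERIV_heat_erfc_y DERIV_heat_erfc_dk_y simp: C)
      (simp add: algebra_simps power2_eq_square)
  have bc: "qy 0 t = b * q 0 t - 1" if t: "t > 0" for t
  proof -
    \<comment> \<open>The \<open>robin\<close> equations leave the roots a and -a with equal
      weights; erfc(-x) + erfc(x) = 2 then yields the constant -1 of the boundary condition.\<close>
    have sum: "exp (- a\<^sup>2 * t) * (heat_erfc (- a) 0 t + heat_erfc a 0 t) = 2"
      using t by (simp add: heat_erfc_def erfc_minus algebra_simps mult_exp_exp)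
    have "qy 0 t - b * q 0 t = exp (- a\<^sup>2 * t) * (- (A * (a + b)) * heat_erfc (- a) 0 t
       + (B * (a - b) + G) * heat_erfc a 0 t + (G * (a - b)) * heat_erfc_dk a 0 t)"
      unfolding qy_def q_pos[OF t] by (simp add: algebra_simps)
    also have "\<dots> = - 1 / 2 * (exp (- a\<^sup>2 * t) * (heat_erfc (- a) 0 t + heat_erfc a 0 t))"
      unfolding robin by (simp add: algebra_simps)
    finally show ?thesis unfolding sum by simp
  qed
  have flux0: "qyy 0 t - a\<^sup>2 * q 0 t = exp (- a\<^sup>2 * t) * resolvent b (sqrt t) / sqrt t" if t: "t > 0" for t
  proof -
    have "qyy 0 t - a\<^sup>2 * q 0 t = exp (- a\<^sup>2 * t) * ((a * A - a * B - b * C - G) * heat_kernel 0 t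
        + (C * (b\<^sup>2 - a\<^sup>2) * heat_erfc b 0 t + 2 * a * G * heat_erfc a 0 t))"
      unfolding qyy_def q_pos[OF t] by (simp add: algebra_simps power2_eq_square)
    \<comment> \<open>In the first alternative of \<open>flux(2)\<close> the
      \<open>heat_erfc b\<close> term supplies the right-hand side; in the second, a = b and the
      term from \<open>heat_erfc_dk\<close> does.\<close>
    also have "C * (b\<^sup>2 - a\<^sup>2) * heat_erfc b 0 t + 2 * a * G * heat_erfc a 0 t = - b * heat_erfc b 0 t"
      using flux(2) by auto
    finally show ?thesis
      unfolding flux(1) heat_kernel_at_0 heat_erfc_at_0[OF t] resolvent_def using t by (simp add: field_simps)
  qed
  have bound: "\<exists>M. \<forall>y\<ge>0. \<forall>t. 0 < t \<longrightarrow> t \<le> T \<longrightarrow> \<bar>q y t\<bar> \<le> M * sqrt t" for T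
  proof (intro exI allI impI)
    fix y t :: real assume yt: "y \<ge> 0" "0 < t" "t \<le> T"
    define \<kappa> where "\<kappa> = max a b"
    define c where "c = 2 * (1 / sqrt pi + 2 * \<kappa> * sqrt T * exp (\<kappa>\<^sup>2 * T))"
    define L where "L = (\<lambda>k. heat_erfc k y t - heat_erfc 0 y t)"
    define D where "D = heat_erfc_dk a y t"
    have D: "\<bar>D\<bar> \<le> c * sqrt t"
      unfolding c_def D_def by (rule abs_heat_erfc_diff_le) (use yt ab in \<open>auto simp: \<kappa>_def\<close>)
    have L: "\<bar>L k\<bar> \<le> c * sqrt t * \<kappa>" if "\<bar>k\<bar> \<le> \<kappa>" for k
      unfolding c_def L_def by (rule abs_heat_erfc_diff_le) (use yt ab that in auto)
    have "\<bar>q y t\<bar> \<le> \<bar>A * L (- a) + B * L a + C * L b + G * D\<bar>"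
    proof -
      \<comment> \<open>Subtracting \<open>heat_erfc 0\<close> from each term changes nothing
        because A + B + C = 0.\<close>
      have "q y t = exp (- a\<^sup>2 * t) * (A * L (- a) + B * L a + C * L b + G * D)"
        unfolding q_pos[OF yt(2)] L_def C D_def by (simp add: algebra_simps)
      moreover have "exp (- a\<^sup>2 * t) \<le> 1" using yt by simp
      ultimately show ?thesis by (simp add: abs_mult mult_left_le_one_le)
    qed
    also have "\<dots> \<le> \<bar>A\<bar> * \<bar>L (- a)\<bar> + \<bar>B\<bar> * \<bar>L a\<bar> + \<bar>C\<bar> * \<bar>L b\<bar> + \<bar>G\<bar> * \<bar>D\<bar>"
      unfolding abs_mult[symmetric] by linarith
    also have "\<dots> \<le> \<bar>A\<bar> * (c * sqrt t * \<kappa>) + \<bar>B\<bar> * (c * sqrt t * \<kappa>) + \<bar>C\<bar> * (c * sqrt t * \<kappa>) + \<bar>G\<bar> * (c * sqrt t)"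
      using ab by (intro add_mono mult_left_mono L D) (auto simp: \<kappa>_def)
    finally show "\<bar>q y t\<bar> \<le> (((\<bar>A\<bar> + \<bar>B\<bar> + \<bar>C\<bar>) * max a b + \<bar>G\<bar>) *
        (2 * (1 / sqrt pi + 2 * max a b * sqrt T * exp ((max a b)\<^sup>2 * T)))) * sqrt t"
      unfolding c_def[symmetric] \<kappa>_def[symmetric] by (simp add: algebra_simps)
  qed
  have bound': "\<exists>M. \<forall>y\<ge>0. \<forall>t\<in>{0..T}. \<bar>q y t\<bar> \<le> M * sqrt t" for T
  proof -
    obtain M where "\<forall>y\<ge>0. \<forall>t. 0 < t \<longrightarrow> t \<le> T \<longrightarrow> \<bar>q y t\<bar> \<le> M * sqrt t"
      using bound by blast
    then have "\<bar>q y t\<bar> \<le> M * sqrt t" if "y \<ge> 0" "t \<in> {0..T}" for y t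
      using that by (cases "t = 0") (auto simp: q_def)
    then show ?thesis by blast
  qed
  have bounded: "\<exists>M. \<forall>y\<ge>0. \<forall>t\<in>{0..T}. \<bar>q y t\<bar> \<le> M" for T
  proof -
    obtain M where M: "\<forall>y\<ge>0. \<forall>t\<in>{0..T}. \<bar>q y t\<bar> \<le> M * sqrt t"
      using bound' by blast
    have "\<bar>q y t\<bar> \<le> \<bar>M\<bar> * sqrt T" if "y \<ge> 0" "t \<in> {0..T}" for y t
    proof -
      have "M * sqrt t \<le> \<bar>M\<bar> * sqrt T"
        using that by (intro mult_mono) auto
      then show ?thesis using M that by force
    qed
    then show ?thesis by blast
  qed
  have cont: "continuous_on ({0..} \<times> {0..}) (\<lambda>(y, t). q y t)"
    unfolding continuous_on_def
  proof (rule ballI)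
    fix p :: "real \<times> real" assume "p \<in> {0..} \<times> {0..}"
    then obtain y t where p: "p = (y, t)" and yt: "y \<ge> 0" "t \<ge> 0" by auto
    let ?S = "{0..} \<times> {0..} :: (real \<times> real) set"
    have "((\<lambda>(y, t). q y t) \<longlongrightarrow> q y t) (at (y, t) within ?S)"
    \<comment> \<open>For t > 0 continuity is read off the formula; at t = 0, corner included, the
      uniform sqrt t bound forces the limit 0.\<close>
    proof (cases "t = 0")
      case False
      with yt have t: "t > 0" by simp
      let ?f = "\<lambda>(y, t). exp (- a\<^sup>2 * t) *
        (A * heat_erfc (- a) y t + B * heat_erfc a y t + C * heat_erfc b y t + G * heat_erfc_dk a y t)"
      have op: "open (UNIV \<times> {0<..} :: (real \<times> real) set)" by (intro open_Times) auto
      have "continuous_on (UNIV \<times> {0<..}) ?f"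
        unfolding heat_erfc_dk_def heat_erfc_def heat_kernel_def case_prod_unfold
        by (intro continuous_intros) auto
      then have "isCont ?f (y, t)"
        using op t by (simp add: continuous_on_eq_continuous_at)
      then have "(?f \<longlongrightarrow> ?f (y, t)) (at (y, t) within ?S)"
        unfolding isCont_def by (rule tendsto_within_subset) simp
      moreover have "eventually (\<lambda>p. ?f p = (case p of (y, t) \<Rightarrow> q y t)) (at (y, t) within ?S)"
      proof -
        have "eventually (\<lambda>p. p \<in> UNIV \<times> {0<..}) (at (y, t) within ?S)"
          unfolding eventually_at_topological using op t by (intro exI[of _ "UNIV \<times> {0<..}"]) auto
        then show ?thesis by eventually_elim (auto simp: q_pos)
      qed
      ultimately show ?thesis
        using t by (simp add: q_pos) (erule Lim_transform_eventually, assumption)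
    next
      case True
      obtain M where M: "\<forall>y\<ge>0. \<forall>t\<in>{0..1}. \<bar>q y t\<bar> \<le> M * sqrt t"
        using bound' by blast
      have "((\<lambda>p. M * sqrt (snd p)) \<longlongrightarrow> M * sqrt (snd (y, t))) (at (y, t) within ?S)"
        by (intro tendsto_intros)
      then have lim: "((\<lambda>p. M * sqrt (snd p)) \<longlongrightarrow> 0) (at (y, t) within ?S)"
        using True by simp
      have "eventually (\<lambda>p. p \<in> UNIV \<times> {..<1}) (at (y, t) within ?S)"
        unfolding eventually_at_topological using True
        by (intro exI[of _ "UNIV \<times> {..<1}"]) (auto intro: open_Times)
      moreover have "eventually (\<lambda>p. p \<in> ?S) (at (y, t) within ?S)"
        by (simp add: eventually_at_filter)
      ultimately have "eventually (\<lambda>p. norm (case p of (y, t) \<Rightarrow> q y t) \<le> M * sqrt (snd p)) (at (y, t) within ?S)"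
        by eventually_elim (use M in auto)
      from Lim_null_comparison[OF this lim] show ?thesis
        using True by (simp add: q_def)
    qed
    then show "((\<lambda>(y, t). q y t) \<longlongrightarrow> (case p of (y, t) \<Rightarrow> q y t)) (at p within ?S)"
      by (simp add: p)
  qed
  have "robin_profile a b q qy qyy"
    unfolding robin_profile_def using q_t q_y q_yy bc flux0 cont bounded by (simp add: q_def)
  then show ?thesis by blast
qed

lemma robin_profile_exists:
  assumes "a \<ge> 0" "b > 0"
  shows "\<exists>q qy qyy. robin_profile a b q qy qyy"
proof (cases "a = b")
  case True
  \<comment> \<open>Here a = b > 0 and the values are C, A, B, G in this order. G is negative
    because \<open>heat_erfc_dk\<close> corresponds to -1 / (sqrt \<mu> + k)^2.\<close>
  show ?thesis
    by (rule robin_profile_combination[of a b 0 "1 / (4 * a)" "- 1 / (4 * a)" "- 1 / 2"])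
      (use assms True in \<open>auto simp: field_simps\<close>)
next
  case False
  then have ne: "b - a \<noteq> 0" "a + b \<noteq> 0" "b\<^sup>2 - a\<^sup>2 = (b - a) * (a + b)"
    using assms by (auto simp: algebra_simps power2_eq_square)
  \<comment> \<open>For a > 0 the three fractions are the residues at sqrt \<mu> = -b, a, -a, taken
    as C, A, B.\<close>
  show ?thesis
  proof (rule robin_profile_combination[of a b "- b / ((b - a) * (a + b))" "1 / (2 * (a + b))" "1 / (2 * (b - a))" 0])
    show "- b / ((b - a) * (a + b)) = - (1 / (2 * (a + b))) - 1 / (2 * (b - a))"
      using ne(1,2) by (simp add: divide_simps) (simp add: algebra_simps)
    show "a * (1 / (2 * (a + b))) - a * (1 / (2 * (b - a))) - b * (- b / ((b - a) * (a + b))) - 0 = 1"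
      using ne(1,2) by (simp add: divide_simps) (simp add: algebra_simps)
    show "1 / (2 * (b - a)) * (a - b) + 0 = - 1 / 2"
      using ne(1) by (simp add: divide_simps)
    show "1 / (2 * (a + b)) * (a + b) = 1 / 2"
      using ne(2) by (simp add: divide_simps)
  qed (use ne assms in auto)
qed

section \<open>Uniqueness for the Robin problem\<close>

text \<open>If f'' were positive at the single point y, then f' would be positive just to the right
  of its zero y and f would rise. No continuity of f'' enters, matching the regularity assumed of
  V.\<close>

lemma DERIV_interior_max:
  fixes f f' :: "real \<Rightarrow> real"
  assumes "d > 0" "\<And>x. \<bar>x - y\<bar> < d \<Longrightarrow> (f has_real_derivative f' x) (at x)"
    and max: "\<And>x. \<bar>x - y\<bar> < d \<Longrightarrow> f x \<le> f y" and f'': "(f' has_real_derivative D) (at y)"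
  shows "D \<le> 0"
proof (rule ccontr)
  assume "\<not> D \<le> 0"
  have "f' y = 0"
    using assms by (intro DERIV_local_max[of f "f' y" y d]) (auto simp: abs_minus_commute)
  obtain e where e: "e > 0" "\<And>h. 0 < h \<Longrightarrow> h < e \<Longrightarrow> f' y < f' (y + h)"
    using DERIV_pos_inc_right[OF f''] \<open>\<not> D \<le> 0\<close> by force
  define h where "h = min d e / 2"
  have h: "0 < h" "h < d" "h < e" using \<open>d > 0\<close> e(1) by (auto simp: h_def)
  have "f y < f (y + h)"
  proof (rule DERIV_pos_imp_increasing_open[of y "y + h" f])
    fix x assume x: "y < x" "x < y + h"
    have "f' x > 0" using e(2)[of "x - y"] x h \<open>f' y = 0\<close> by simp
    then show "\<exists>D. (f has_real_derivative D) (at x) \<and> D > 0"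
      using assms(2)[of x] x h by auto
  next
    show "continuous_on {y..y + h} f"
      by (rule DERIV_continuous_on[where D = f'], rule DERIV_subset[OF assms(2)]) (use h in auto)
  qed (use h in simp)
  with max[of "y + h"] h show False by simp
qed

text \<open>Boundary version: a derivative at 0 itself is not assumed, but a positive limit of f'
  would make f increase away from 0.\<close>

lemma right_limit_deriv_max:
  fixes f f' :: "real \<Rightarrow> real"
  assumes "d > 0" "\<And>x. 0 < x \<Longrightarrow> x < d \<Longrightarrow> (f has_real_derivative f' x) (at x)"
    and "continuous_on {0..<d} f" "\<And>x. 0 < x \<Longrightarrow> x < d \<Longrightarrow> f x \<le> f 0"
    and "(f' \<longlongrightarrow> p) (at_right 0)"
  shows "p \<le> 0"
proof (rule ccontr)
  assume "\<not> p \<le> 0"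
  then have "eventually (\<lambda>x. f' x > 0) (at_right 0)"
    using order_tendstoD(1)[OF assms(5), of 0] by simp
  then obtain e where e: "e > 0" "\<And>x. 0 < x \<Longrightarrow> x < e \<Longrightarrow> f' x > 0"
    by (auto simp: eventually_at_right_field)
  define h where "h = min d e / 2"
  have h: "0 < h" "h < d" "h < e" using \<open>d > 0\<close> e(1) by (auto simp: h_def)
  have "f 0 < f h"
  proof (rule DERIV_pos_imp_increasing_open[of 0 h f])
    show "\<exists>D. (f has_real_derivative D) (at x) \<and> D > 0" if "0 < x" "x < h" for x
      using assms(2)[of x] e(2)[of x] that h by auto
    show "continuous_on {0..h} f"
      by (rule continuous_on_subset[OF assms(3)]) (use h in auto)
  qed (use h in simp)
  with assms(4)[of h] h show False by simp
qed

text \<open>A positive value leads to a positive maximum of the penalised function \<open>z\<close>.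
  The initial data exclude t = 0, the penalty excludes the far end, the Robin condition with b > 0
  excludes y = 0, and the equation excludes the interior.\<close>

lemma robin_maximum_principle:
  fixes w wt wy wyy :: "real \<Rightarrow> real \<Rightarrow> real"
  assumes "b > 0"
    and cont: "continuous_on ({0..} \<times> {0..}) (\<lambda>(y, t). w y t)"
    and bound: "\<And>y t. y \<ge> 0 \<Longrightarrow> 0 \<le> t \<Longrightarrow> t \<le> T \<Longrightarrow> w y t \<le> M"
    and init: "\<And>y. y \<ge> 0 \<Longrightarrow> w y 0 \<le> 0"
    and wt: "\<And>y t. y > 0 \<Longrightarrow> t > 0 \<Longrightarrow> ((\<lambda>s. w y s) has_real_derivative wt y t) (at t)"
    and wy: "\<And>y t. y > 0 \<Longrightarrow> t > 0 \<Longrightarrow> ((\<lambda>x. w x t) has_real_derivative wy y t) (at y)"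
    and wyy: "\<And>y t. y > 0 \<Longrightarrow> t > 0 \<Longrightarrow> ((\<lambda>x. wy x t) has_real_derivative wyy y t) (at y)"
    and eq: "\<And>y t. y > 0 \<Longrightarrow> t > 0 \<Longrightarrow> wt y t = wyy y t - a\<^sup>2 * w y t"
    and bc: "\<And>t. t > 0 \<Longrightarrow> ((\<lambda>x. wy x t) \<longlongrightarrow> b * w 0 t) (at_right 0)"
    and yT: "y \<ge> 0" "T \<ge> 0"
  shows "w y T \<le> 0"
proof (rule ccontr)
  assume pos: "\<not> w y T \<le> 0"
  \<comment> \<open>The quadratic penalty confines the maximum to a compact set and is a strict supersolution,
    since \<open>3 > 2\<close>.\<close>
  define \<epsilon> where "\<epsilon> = w y T / (2 * (y\<^sup>2 + 3 * T + 1))"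
  have den: "y\<^sup>2 + 3 * T + 1 > 0" using yT by (simp add: add_nonneg_pos)
  then have \<epsilon>: "\<epsilon> > 0" using pos by (simp add: \<epsilon>_def)
  define z where "z = (\<lambda>y t. w y t - \<epsilon> * (y\<^sup>2 + 3 * t + 1))"
  \<comment> \<open>\<open>\<epsilon>\<close> is chosen so that the penalty at (y, T) consumes half
    of \<open>w y T\<close>, leaving \<open>z\<close> positive there.\<close>
  have "w y T / (2 * d) * d = w y T / 2" if "d > 0" for d :: real
    using that by simp
  from this[OF den] have "\<epsilon> * (y\<^sup>2 + 3 * T + 1) = w y T / 2"
    unfolding \<epsilon>_def .
  then have zpos: "z y T > 0" using pos by (simp add: z_def)
  \<comment> \<open>The rectangle must contain \<open>y\<close> and satisfy M \<le> \<epsilon> R^2,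
    so that \<open>z\<close> is negative on its artificial side.\<close>
  define R where "R = y + 1 + \<bar>M\<bar> / \<epsilon>"
  have R1: "R \<ge> 1" "y \<le> R" using yT \<epsilon> by (auto simp: R_def)
  have "\<bar>M\<bar> = \<epsilon> * (\<bar>M\<bar> / \<epsilon>)" using \<epsilon> by simp
  also have "\<dots> \<le> \<epsilon> * R" using \<epsilon> yT by (intro mult_left_mono) (auto simp: R_def)
  also have "\<dots> \<le> \<epsilon> * R\<^sup>2" using \<epsilon> R1 by (intro mult_left_mono self_le_power) auto
  finally have MR: "M \<le> \<epsilon> * R\<^sup>2" by simp
  have "continuous_on ({0..R} \<times> {0..T}) (\<lambda>p. (case p of (y, t) \<Rightarrow> w y t) - \<epsilon> * ((fst p)\<^sup>2 + 3 * snd p + 1))"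
    by (intro continuous_intros continuous_on_subset[OF cont]) auto
  then have "continuous_on ({0..R} \<times> {0..T}) (\<lambda>(y, t). z y t)"
    by (simp add: z_def case_prod_unfold)
  moreover have "compact ({0..R} \<times> {0..T})" by (intro compact_Times) auto
  moreover have "{0..R} \<times> {0..T} \<noteq> {}" using R1 yT by auto
  ultimately obtain y0 t0 where y0: "0 \<le> y0" "y0 \<le> R" and t0: "0 \<le> t0" "t0 \<le> T"
    and max: "\<And>x s. 0 \<le> x \<Longrightarrow> x \<le> R \<Longrightarrow> 0 \<le> s \<Longrightarrow> s \<le> T \<Longrightarrow> z x s \<le> z y0 t0"
    using continuous_attains_sup[of "{0..R} \<times> {0..T}" "\<lambda>(y, t). z y t"] by fastforce
  have z0: "z y0 t0 > 0" using max[of y T] zpos yT R1 by linarith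
  have "t0 \<noteq> 0"
  proof
    assume "t0 = 0"
    then have "z y0 t0 \<le> 0 - \<epsilon> * (y0\<^sup>2 + 1)" using init[OF y0(1)] by (simp add: z_def)
    moreover have "\<epsilon> * (y0\<^sup>2 + 1) > 0" using \<epsilon> by (simp add: add_nonneg_pos)
    ultimately show False using z0 by simp
  qed
  with t0 have t0': "t0 > 0" by simp
  have "y0 \<noteq> R"
  proof
    assume "y0 = R"
    then have "z y0 t0 \<le> M - \<epsilon> * R\<^sup>2 - \<epsilon> * (3 * t0 + 1)"
      using bound[OF y0(1) t0] by (simp add: z_def algebra_simps)
    moreover have "\<epsilon> * (3 * t0 + 1) > 0" using \<epsilon> t0' by simp
    ultimately show False using z0 MR by linarith
  qed
  with y0 have yR: "y0 < R" by simp
  have zy: "((\<lambda>x. z x t0) has_real_derivative wy x t0 - 2 * \<epsilon> * x) (at x)" if "x > 0" for x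
    unfolding z_def using wy[OF that t0'] by (auto intro!: derivative_eq_intros)
  have w0: "w y0 t0 > 0"
  proof -
    have "\<epsilon> * (y0\<^sup>2 + 3 * t0 + 1) \<ge> 0" using \<epsilon> t0' by simp
    then show ?thesis using z0 by (simp add: z_def)
  qed
  show False
  proof (cases "y0 = 0")
    case True
    have "continuous_on {0..<R} (\<lambda>x. z x t0)"
    proof -
      have "continuous_on {0..<R} (\<lambda>x. case (x, t0) of (y, t) \<Rightarrow> w y t)"
        by (rule continuous_on_compose2[OF cont]) (use t0 in \<open>auto intro!: continuous_intros\<close>)
      then show ?thesis unfolding z_def by (intro continuous_intros) auto
    qed
    moreover have "((\<lambda>x. wy x t0 - 2 * \<epsilon> * x) \<longlongrightarrow> b * w 0 t0 - 2 * \<epsilon> * 0) (at_right 0)"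
      by (intro tendsto_intros bc t0')
    ultimately have "b * w 0 t0 - 2 * \<epsilon> * 0 \<le> 0"
      using True yR t0 max by (intro right_limit_deriv_max[of R "\<lambda>x. z x t0" "\<lambda>x. wy x t0 - 2 * \<epsilon> * x"]) (auto intro: zy)
    moreover have "b * w 0 t0 > 0"
      using w0 True \<open>b > 0\<close> by simp
    ultimately show False by simp
  next
    case False
    with y0 have y0': "y0 > 0" by simp
    have "wyy y0 t0 - 2 * \<epsilon> \<le> 0"
    proof (rule DERIV_interior_max[of "min y0 (R - y0)" y0 "\<lambda>x. z x t0" "\<lambda>x. wy x t0 - 2 * \<epsilon> * x"])
      show "((\<lambda>x. wy x t0 - 2 * \<epsilon> * x) has_real_derivative wyy y0 t0 - 2 * \<epsilon>) (at y0)"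
        using wyy[OF y0' t0'] by (auto intro!: derivative_eq_intros)
    qed (use y0' yR t0 in \<open>auto intro!: zy max\<close>)
    \<comment> \<open>The maximum may sit at the final time T, so only earlier times are compared.
      The result, 3 \<epsilon> \<le> w_t = w_yy - a^2 w \<le> 2 \<epsilon>, is absurd.\<close>
    moreover have "wt y0 t0 - 3 * \<epsilon> \<ge> 0"
    proof (rule ccontr)
      assume neg: "\<not> wt y0 t0 - 3 * \<epsilon> \<ge> 0"
      have "((\<lambda>s. z y0 s) has_real_derivative wt y0 t0 - 3 * \<epsilon>) (at t0)"
        unfolding z_def using wt[OF y0' t0'] by (auto intro!: derivative_eq_intros)
      from DERIV_neg_dec_left[OF this] neg obtain d where d: "d > 0" "\<And>h. 0 < h \<Longrightarrow> h < d \<Longrightarrow> z y0 t0 < z y0 (t0 - h)"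
        by force
      define h where "h = min d t0 / 2"
      have "0 < h" "h < d" "h < t0" using d(1) t0' by (auto simp: h_def)
      then show False using d(2)[of h] max[of y0 "t0 - h"] y0 t0 by simp
    qed
    moreover have "a\<^sup>2 * w y0 t0 \<ge> 0" using w0 by simp
    ultimately show False using eq[OF y0' t0'] \<epsilon> by linarith
  qed
qed

section \<open>Identification of V at y = 0\<close>

text \<open>The difference \<open>w\<close> between the even part of V and the explicit solution has
  zero initial data and a homogeneous Robin condition; the maximum principle applies to
  \<open>w\<close> and to \<open>- w\<close>.\<close>

lemma delta_solution_at_0:
  assumes ab: "a \<ge> 0" "b > 0"
    and V: "bounded_delta_solution a b (\<lambda>y. 1 - c * exp (- a * \<bar>y\<bar>)) V"
    and q: "robin_profile a b q qy qyy"
    and T: "T \<ge> 0"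
  shows "V 0 T = 1 - c - (b * (1 - c) - a * c) * q 0 T"
proof -
  define \<eta> where "\<eta> = b * (1 - c) - a * c"
  define Vt where "Vt = (\<lambda>y t. deriv (\<lambda>s. V y s) t)"
  define Vy where "Vy = (\<lambda>y t. deriv (\<lambda>x. V x t) y)"
  define Vyy where "Vyy = (\<lambda>y t. deriv (deriv (\<lambda>x. V x t)) y)"
  define w where "w = (\<lambda>y t. (V y t + V (- y) t) / 2 - 1 + c * exp (- a * y) + \<eta> * q y t)"
  define wt where "wt = (\<lambda>y t. (Vt y t + Vt (- y) t) / 2 + \<eta> * (qyy y t - a\<^sup>2 * q y t))"
  define wy where "wy = (\<lambda>y t. (Vy y t - Vy (- y) t) / 2 - a * c * exp (- a * y) + \<eta> * qy y t)"
  define wyy where "wyy = (\<lambda>y t. (Vyy y t + Vyy (- y) t) / 2 + a\<^sup>2 * c * exp (- a * y) + \<eta> * qyy y t)"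
  have contV: "continuous_on (UNIV \<times> {0..}) (\<lambda>(y, t). V y t)"
    and V0: "V y 0 = 1 - c * exp (- a * \<bar>y\<bar>)" for y
    using V unfolding bounded_delta_solution_def by auto
  have diffV: "(\<lambda>s. V y s) differentiable (at t) \<and>
        (\<lambda>x. V x t) differentiable (at y) \<and> (\<lambda>x. Vy x t) differentiable (at y) \<and>
        Vt y t = Vyy y t - a\<^sup>2 * (V y t - 1)" if "y \<noteq> 0" "t > 0" for y t
    using V that unfolding bounded_delta_solution_def Vt_def Vy_def Vyy_def by blast
  have dV: "((\<lambda>s. V y s) has_real_derivative Vt y t) (at t)"
      "((\<lambda>x. V x t) has_real_derivative Vy y t) (at y)"
      "((\<lambda>x. Vy x t) has_real_derivative Vyy y t) (at y)"
      "Vt y t = Vyy y t - a\<^sup>2 * (V y t - 1)" if "y \<noteq> 0" "t > 0" for y t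
    using diffV[OF that] unfolding Vt_def Vyy_def DERIV_deriv_iff_real_differentiable Vy_def
    by (blast intro: DERIV_deriv_iff_real_differentiable[THEN iffD2])+
  have dq: "((\<lambda>s. q y s) has_real_derivative qyy y t - a\<^sup>2 * q y t) (at t)"
      "((\<lambda>x. q x t) has_real_derivative qy y t) (at y)"
      "((\<lambda>x. qy x t) has_real_derivative qyy y t) (at y)"
      "qy 0 t = b * q 0 t - 1" if "t > 0" for y t
    using q that unfolding robin_profile_def by blast+
  have contq: "continuous_on ({0..} \<times> {0..}) (\<lambda>(y, t). q y t)" and q0: "q y 0 = 0" for y
    using q unfolding robin_profile_def by blast+
  obtain Mq where Mq: "\<And>y t. y \<ge> 0 \<Longrightarrow> 0 \<le> t \<Longrightarrow> t \<le> T \<Longrightarrow> \<bar>q y t\<bar> \<le> Mq"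
    using q unfolding robin_profile_def by (meson atLeastAtMost_iff)
  obtain MV where MV: "\<And>y t. 0 \<le> t \<Longrightarrow> \<bar>V y t\<bar> \<le> MV"
    using V unfolding bounded_delta_solution_def bounded_iff by auto
  have cont: "continuous_on ({0..} \<times> {0..}) (\<lambda>(y, t). w y t)"
  proof -
    have "continuous_on ({0..} \<times> {0..}) (\<lambda>p. case (- fst p, snd p) of (y, t) \<Rightarrow> V y t)"
      by (rule continuous_on_compose2[OF contV]) (auto intro!: continuous_intros)
    moreover have "continuous_on ({0..} \<times> {0..}) (\<lambda>(y, t). V y t)"
      by (rule continuous_on_subset[OF contV]) auto
    ultimately show ?thesis
      using contq unfolding w_def case_prod_unfold by (auto intro!: continuous_intros)
  qed
  have bound: "\<bar>w y t\<bar> \<le> MV + 1 + \<bar>c\<bar> + \<bar>\<eta>\<bar> * Mq" if "y \<ge> 0" "0 \<le> t" "t \<le> T" for y t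
  proof -
    have "\<bar>c * exp (- a * y)\<bar> \<le> \<bar>c\<bar>"
      using ab that by (simp add: abs_mult mult_left_le)
    moreover have "\<bar>\<eta> * q y t\<bar> \<le> \<bar>\<eta>\<bar> * Mq"
      unfolding abs_mult by (intro mult_left_mono Mq that) simp
    ultimately show ?thesis
      using MV[of t y] MV[of t "- y"] that unfolding w_def by (simp add: field_simps)
  qed
  have wt: "((\<lambda>s. w y s) has_real_derivative wt y t) (at t)" if "y > 0" "t > 0" for y t
    unfolding w_def wt_def using that dV(1)[of y t] dV(1)[of "- y" t] dq(1)[of t y]
    by (auto intro!: derivative_eq_intros)
  have wy: "((\<lambda>x. w x t) has_real_derivative wy y t) (at y)" if "y > 0" "t > 0" for y t
    unfolding w_def wy_def using that
    by (auto intro!: derivative_eq_intros dq(2) dV(2) DERIV_chain2[OF dV(2), of "\<lambda>x. - x"])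
  have wyy: "((\<lambda>x. wy x t) has_real_derivative wyy y t) (at y)" if "y > 0" "t > 0" for y t
    unfolding wy_def wyy_def using that
    by (auto intro!: derivative_eq_intros dq(3) dV(3) DERIV_chain2[OF dV(3), of "\<lambda>x. - x"] simp: power2_eq_square)
  have eq: "wt y t = wyy y t - a\<^sup>2 * w y t" if "y > 0" "t > 0" for y t
    unfolding wt_def wyy_def w_def using that by (simp add: dV(4) field_simps)
  have bc: "((\<lambda>x. wy x t) \<longlongrightarrow> b * w 0 t) (at_right 0)" if "t > 0" for t
  proof -
    obtain p r where p: "((\<lambda>y. Vy y t) \<longlongrightarrow> p) (at_right 0)" and r: "((\<lambda>y. Vy y t) \<longlongrightarrow> r) (at_left 0)"
      and jump: "p - r = 2 * b * V 0 t"
      using V \<open>t > 0\<close> unfolding bounded_delta_solution_def Vy_def by blast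
    have r': "((\<lambda>y. Vy (- y) t) \<longlongrightarrow> r) (at_right 0)"
      using r unfolding at_left_minus filterlim_filtermap by simp
    have "isCont (\<lambda>x. qy x t) 0" using dq(3)[OF that] by (rule DERIV_isCont)
    then have "((\<lambda>x. qy x t) \<longlongrightarrow> qy 0 t) (at_right 0)"
      unfolding isCont_def by (rule tendsto_within_subset) simp
    then have "((\<lambda>x. wy x t) \<longlongrightarrow> (p - r) / 2 - a * c * exp (- a * 0) + \<eta> * qy 0 t) (at_right 0)"
      unfolding wy_def by (intro tendsto_intros p r') simp
    \<comment> \<open>Taking the even part halves the jump, giving b V. The constant \<eta> is what
      the stationary part 1 - c exp(-a y) lacks in the Robin condition: b (1 - c) - a c.\<close>
    also have "(p - r) / 2 - a * c * exp (- a * 0) + \<eta> * qy 0 t = b * w 0 t"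
      unfolding jump dq(4)[OF that] by (simp add: w_def \<eta>_def algebra_simps)
    finally show ?thesis .
  qed
  have init: "w y 0 = 0" if "y \<ge> 0" for y
    using that by (simp add: w_def q0 V0 field_simps)
  have "w 0 T \<le> 0"
    by (rule robin_maximum_principle[OF ab(2) cont abs_le_D1[OF bound] _ wt wy wyy eq bc])
      (use init T in auto)
  moreover have "- w 0 T \<le> 0"
  proof (rule robin_maximum_principle[where w = "\<lambda>y t. - w y t" and a = a, OF ab(2) _ abs_le_D2[OF bound] _ DERIV_minus[OF wt] DERIV_minus[OF wy] DERIV_minus[OF wyy]])
    show "continuous_on ({0..} \<times> {0..}) (\<lambda>(y, t). - w y t)"
      using continuous_on_minus[OF cont] by (simp add: case_prod_unfold)
    show "((\<lambda>x. - wy x t) \<longlongrightarrow> b * - w 0 t) (at_right 0)" if "t > 0" for t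
      using tendsto_minus[OF bc[OF that]] by simp
  qed (use init T eq in auto)
  ultimately have "w 0 T = 0" by simp
  then show ?thesis by (simp add: w_def \<eta>_def)
qed

section \<open>The kernel and the convolution identity\<close>

lemma f_kernel_half: "t > 0 \<Longrightarrow> f_kernel \<alpha> (1 / 2) t = exp (- \<alpha> * t) / (sqrt pi * sqrt t)"
  by (simp add: f_kernel_def Gamma_one_half_real powr_minus powr_half_sqrt field_simps)

text \<open>The integrand is singular at 0 but nonnegative, so an antiderivative with limits at both
  ends suffices.\<close>

lemma LINT_f_kernel_half:
  assumes "a > 0" "t > 0"
  shows "(LINT s:{0<..<t}|lborel. f_kernel (a\<^sup>2) (1 / 2) s) = (1 - erfc (a * sqrt t)) / a"
proof -
  have lim: "((\<lambda>s. - erfc (a * sqrt s) / a) \<longlongrightarrow> - erfc (a * sqrt u) / a) (at u within A)" for u A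
    using assms by (intro tendsto_intros isCont_tendsto_compose[OF isCont_erfc]) auto
  have "(LBINT s=ereal 0..ereal t. f_kernel (a\<^sup>2) (1 / 2) s) = - erfc (a * sqrt t) / a - (- erfc (a * sqrt 0) / a)"
  proof (rule interval_integral_FTC_nonneg(2)[where F = "\<lambda>s. - erfc (a * sqrt s) / a"])
    fix x assume "ereal 0 < ereal x" "ereal x < ereal t"
    then have x: "x > 0" by simp
    show "((\<lambda>s. - erfc (a * sqrt s) / a) has_real_derivative f_kernel (a\<^sup>2) (1 / 2) x) (at x)"
      using x assms by (auto intro!: derivative_eq_intros simp: f_kernel_half power_mult_distrib field_simps)
    have "isCont (\<lambda>s. exp (- a\<^sup>2 * s) / (sqrt pi * sqrt s)) x"
      using x by (intro continuous_intros) auto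
    moreover have "eventually (\<lambda>s. f_kernel (a\<^sup>2) (1 / 2) s = exp (- a\<^sup>2 * s) / (sqrt pi * sqrt s)) (nhds x)"
      using x by (intro eventually_mono[OF eventually_nhds_in_open[of "{0<..}"]]) (auto simp: f_kernel_half)
    ultimately show "isCont (f_kernel (a\<^sup>2) (1 / 2)) x"
      by (simp add: isCont_cong)
  next
    show "AE x in lborel. ereal 0 < ereal x \<longrightarrow> ereal x < ereal t \<longrightarrow> 0 \<le> f_kernel (a\<^sup>2) (1 / 2) x"
      by (auto simp: f_kernel_half)
  qed (use assms in \<open>simp, auto simp only: ereal_tendsto_simps1 intro!: lim\<close>)
  then show ?thesis
    using assms by (simp add: interval_lebesgue_integral_def erfc_0 field_simps)
qed

lemma m_kernel_eq_erfc:
  assumes "a \<ge> 0" "t > 0"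
  shows "m_kernel a t = 2 * (exp (- a\<^sup>2 * t) / (sqrt pi * sqrt t) - a * erfc (a * sqrt t))"
proof (cases "a = 0")
  case False
  with assms have "a > 0" by simp
  show ?thesis
    unfolding m_kernel_def LINT_f_kernel_half[OF \<open>a > 0\<close> assms(2)] f_kernel_half[OF assms(2)]
    using \<open>a > 0\<close> by (simp add: field_simps power2_eq_square)
qed (use assms in \<open>simp add: m_kernel_def f_kernel_half\<close>)

lemma m_kernel_eq_resolvent:
  assumes "a \<ge> 0" "t > 0"
  shows "m_kernel a t = 2 * (exp (- a\<^sup>2 * t) * resolvent a (sqrt t) / sqrt t)"
proof -
  have "exp (- a\<^sup>2 * t) * scaled_erfc a (sqrt t) = erfc (a * sqrt t)"
    using assms by (simp add: scaled_erfc_def mult.assoc[symmetric] mult_exp_exp)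
  then show ?thesis
    using assms unfolding m_kernel_eq_erfc[OF assms] resolvent_def
    by (simp add: field_simps)
qed

text \<open>Differentiating the exponential and the erfc term gives opposite contributions; only the
  derivative of t^(-1/2) survives.\<close>

lemma DERIV_m_kernel:
  assumes "a \<ge> 0" "t > 0"
  shows "(m_kernel a has_real_derivative - exp (- a\<^sup>2 * t) / (sqrt pi * t * sqrt t)) (at t)"
proof (rule has_field_derivative_transform_within_open)
  show "((\<lambda>t. 2 * (exp (- a\<^sup>2 * t) * (1 / sqrt t) / sqrt pi - a * erfc (a * sqrt t)))
      has_real_derivative - exp (- a\<^sup>2 * t) / (sqrt pi * t * sqrt t)) (at t)"
  proof -
    have "((\<lambda>t. exp (- a\<^sup>2 * t)) has_real_derivative exp (- a\<^sup>2 * t) * (- a\<^sup>2)) (at t)"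
      by (auto intro!: derivative_eq_intros)
    note 1 = DERIV_cdivide[OF DERIV_mult[OF this DERIV_inverse_sqrt[OF assms(2)]], of "sqrt pi"]
    have "((\<lambda>t. a * sqrt t) has_real_derivative a * (inverse (sqrt t) / 2)) (at t)"
      by (intro DERIV_cmult DERIV_real_sqrt assms)
    note 2 = DERIV_cmult[OF DERIV_diff[OF 1 DERIV_cmult[OF DERIV_erfc[OF this], of a]], of 2]
    show ?thesis
      by (rule DERIV_cong[OF 2]) (use assms in \<open>simp add: power_mult_distrib field_simps power2_eq_square\<close>)
  qed
  show "open {0::real<..}" "t \<in> {0<..}" using assms by auto
  show "2 * (exp (- a\<^sup>2 * t) * (1 / sqrt t) / sqrt pi - a * erfc (a * sqrt t)) = m_kernel a t" if "t \<in> {0<..}" for t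
    using that assms by (simp add: m_kernel_eq_erfc mult.commute)
qed

lemma m_kernel_tendsto_0:
  assumes "a \<ge> 0"
  shows "(m_kernel a \<longlongrightarrow> 0) at_top"
proof -
  have 1: "((\<lambda>t. exp (- a\<^sup>2 * t) / (sqrt pi * sqrt t)) \<longlongrightarrow> 0) at_top"
  proof (rule Lim_null_comparison)
    show "eventually (\<lambda>t. norm (exp (- a\<^sup>2 * t) / (sqrt pi * sqrt t)) \<le> 1 / (sqrt pi * sqrt t)) at_top"
      using eventually_gt_at_top[of 0] by eventually_elim (auto intro!: divide_right_mono)
    show "((\<lambda>t. 1 / (sqrt pi * sqrt t)) \<longlongrightarrow> 0) at_top"
      by real_asymp
  qed
  have 2: "((\<lambda>t. a * erfc (a * sqrt t)) \<longlongrightarrow> 0) at_top"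
  proof (cases "a = 0")
    case False
    then have "a > 0" using assms by simp
    then have "filterlim (\<lambda>t. a * sqrt t) at_top at_top" by real_asymp
    from filterlim_compose[OF erfc_tendsto_0 this] show ?thesis
      by (rule tendsto_mult_right_zero)
  qed simp
  have "((\<lambda>t. 2 * (exp (- a\<^sup>2 * t) / (sqrt pi * sqrt t) - a * erfc (a * sqrt t))) \<longlongrightarrow> 2 * (0 - 0)) at_top"
    by (intro tendsto_intros 1 2)
  then show ?thesis
  proof (rule Lim_transform_eventually[THEN tendsto_eq_rhs])
    show "eventually (\<lambda>t. 2 * (exp (- a\<^sup>2 * t) / (sqrt pi * sqrt t) - a * erfc (a * sqrt t)) = m_kernel a t) at_top"
      using eventually_gt_at_top[of 0] by eventually_elim (simp add: m_kernel_eq_erfc assms)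
  qed simp
qed

section \<open>Evaluation of the convolution integral\<close>

text \<open>The Jacobian 2 t sin \<theta> cos \<theta> vanishes at both ends and absorbs inverse
  square root singularities at 0 and t. Integrability then follows from continuity of
  \<open>h\<close> on a compact interval.\<close>

lemma set_integral_sin_substitution:
  fixes f h :: "real \<Rightarrow> real"
  assumes t: "t > 0" and f: "continuous_on {0<..<t} f" and h: "continuous_on {0..pi / 2} h"
    and eq: "\<And>\<theta>. 0 < \<theta> \<Longrightarrow> \<theta> < pi / 2 \<Longrightarrow> 2 * t * sin \<theta> * cos \<theta> * f (t * (sin \<theta>)\<^sup>2) = h \<theta>"
  shows "set_integrable lborel {0<..<t} f"
    and "(LINT s:{0<..<t}|lborel. f s) = integral {0..pi / 2} h"
proof -
  let ?S = "{0<..<pi / 2}"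
  let ?g = "\<lambda>\<theta>. t * (sin \<theta>)\<^sup>2"
  have sc: "sin \<theta> > 0" "cos \<theta> > 0" "sin \<theta> < 1" if "\<theta> \<in> ?S" for \<theta>
  proof -
    show s: "sin \<theta> > 0" "cos \<theta> > 0" using that by (auto intro: sin_gt_zero cos_gt_zero)
    show "sin \<theta> < 1" using sin_cos_squared_add[of \<theta>] s
      by (smt (verit) one_le_power zero_less_power)
  qed
  have img: "?g ` ?S = {0<..<t}"
  proof (intro equalityI subsetI)
    fix s assume "s \<in> ?g ` ?S"
    then obtain \<theta> where \<theta>: "\<theta> \<in> ?S" "s = ?g \<theta>" by auto
    have "(sin \<theta>)\<^sup>2 < 1" using sc[OF \<theta>(1)] by (simp add: power_less_one_iff)
    then show "s \<in> {0<..<t}" using sc[OF \<theta>(1)] t \<theta>(2) by simp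
  next
    fix s assume s: "s \<in> {0<..<t}"
    define u where "u = sqrt (s / t)"
    have u: "0 < u" "u < 1" "u\<^sup>2 = s / t" using s t by (auto simp: u_def)
    have "0 < arcsin u" "arcsin u < pi / 2"
      using arcsin_less_arcsin[of 0 u] arcsin_less_arcsin[of u 1] u by auto
    moreover have "s = ?g (arcsin u)" using u t by simp
    ultimately show "s \<in> ?g ` ?S" by force
  qed
  have inj: "inj_on ?g ?S"
  proof (rule inj_onI)
    fix \<theta> \<phi> assume *: "\<theta> \<in> ?S" "\<phi> \<in> ?S" "?g \<theta> = ?g \<phi>"
    then have "(sin \<theta>)\<^sup>2 = (sin \<phi>)\<^sup>2" using t by simp
    then have "sin \<theta> = sin \<phi>" using sc[OF *(1)] sc[OF *(2)] by (simp add: power2_eq_iff_nonneg)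
    with *(1,2) show "\<theta> = \<phi>" by (intro sin_inj_pi[of \<theta> \<phi>]) simp_all
  qed
  have der: "(?g has_real_derivative 2 * t * sin \<theta> * cos \<theta>) (at \<theta> within ?S)" for \<theta>
    by (auto intro!: derivative_eq_intros)
  have "set_integrable lborel {0..pi / 2} h"
    by (rule borel_integrable_atLeastAtMost') (rule h)
  then have "set_integrable lborel ?S h"
    by (rule set_integrable_subset) auto
  then have "integrable lborel (\<lambda>\<theta>. indicator ?S \<theta> *\<^sub>R h \<theta>)"
    unfolding set_integrable_def .
  then have h_int: "h absolutely_integrable_on ?S"
    unfolding set_integrable_def using integrable_completion[OF borel_measurable_integrable] by blast
  have h_eq: "\<bar>2 * t * sin \<theta> * cos \<theta>\<bar> * f (?g \<theta>) = h \<theta>" if "\<theta> \<in> ?S" for \<theta>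
    using eq[of \<theta>] sc[OF that] t that by simp
  have "(\<lambda>\<theta>. \<bar>2 * t * sin \<theta> * cos \<theta>\<bar> * f (?g \<theta>)) absolutely_integrable_on ?S"
    by (rule iffD2[OF set_integrable_cong[OF refl refl h_eq] h_int])
  moreover have "integral ?S (\<lambda>\<theta>. \<bar>2 * t * sin \<theta> * cos \<theta>\<bar> * f (?g \<theta>)) = integral {0..pi / 2} h"
    unfolding integral_open_interval_real by (rule integral_cong) (rule h_eq)
  ultimately have *: "f absolutely_integrable_on {0<..<t} \<and> integral {0<..<t} f = integral {0..pi / 2} h"
    using has_absolute_integral_change_of_variables_1'[OF _ der inj, of f "integral {0..pi / 2} h"] unfolding img
    by simp
  \<comment> \<open>The change of variables is carried out for the completed Lebesgue measure; Borel
    measurability brings integrability back to \<open>lborel\<close>.\<close>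
  have meas: "(\<lambda>s. indicator {0<..<t} s *\<^sub>R f s) \<in> borel_measurable lborel"
    using borel_measurable_continuous_on_indicator[OF _ f] by simp
  show int: "set_integrable lborel {0<..<t} f"
    using * integrable_completion[OF meas] unfolding set_integrable_def by simp
  show "(LINT s:{0<..<t}|lborel. f s) = integral {0..pi / 2} h"
    using * set_borel_integral_eq_integral(2)[OF int] by simp
qed

text \<open>Both factors carry the same rate a^2, so their exponentials multiply to the constant
  exp(-a^2 t), while the square roots cancel against the Jacobian.\<close>

lemma set_integral_resolvent_convolution:
  fixes a b t :: real
  defines "r \<equiv> (\<lambda>k s. exp (- a\<^sup>2 * s) * resolvent k (sqrt s) / sqrt s)"
  assumes t: "t > 0"
  shows "set_integrable lborel {0<..<t} (\<lambda>s. r a (t - s) * r b s)"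
    and "(LINT s:{0<..<t}|lborel. r a (t - s) * r b s)
      = 2 * exp (- a\<^sup>2 * t) * integral {0..pi / 2} (\<lambda>\<theta>. resolvent a (sqrt t * cos \<theta>) * resolvent b (sqrt t * sin \<theta>))"
proof -
  let ?h = "\<lambda>\<theta>. 2 * exp (- a\<^sup>2 * t) * (resolvent a (sqrt t * cos \<theta>) * resolvent b (sqrt t * sin \<theta>))"
  have f: "continuous_on {0<..<t} (\<lambda>s. r a (t - s) * r b s)"
    unfolding r_def by (intro continuous_intros) auto
  have h: "continuous_on {0..pi / 2} ?h"
    by (intro continuous_intros)
  have eq: "2 * t * sin \<theta> * cos \<theta> * (r a (t - t * (sin \<theta>)\<^sup>2) * r b (t * (sin \<theta>)\<^sup>2)) = ?h \<theta>"
    if "0 < \<theta>" "\<theta> < pi / 2" for \<theta>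
  proof -
    have sc: "sin \<theta> > 0" "cos \<theta> > 0" using that by (auto intro: sin_gt_zero cos_gt_zero)
    have c: "t - t * (sin \<theta>)\<^sup>2 = t * (cos \<theta>)\<^sup>2" by (simp add: sin_squared_eq algebra_simps)
    have sq: "sqrt (t * (cos \<theta>)\<^sup>2) = sqrt t * cos \<theta>" "sqrt (t * (sin \<theta>)\<^sup>2) = sqrt t * sin \<theta>"
      using sc by (auto simp: real_sqrt_mult)
    have e: "exp (- a\<^sup>2 * (t * (cos \<theta>)\<^sup>2)) * exp (- a\<^sup>2 * (t * (sin \<theta>)\<^sup>2)) = exp (- a\<^sup>2 * t)"
      unfolding exp_add[symmetric] by (simp add: sin_squared_eq algebra_simps)
    have "2 * t * sin \<theta> * cos \<theta> * (r a (t - t * (sin \<theta>)\<^sup>2) * r b (t * (sin \<theta>)\<^sup>2))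
      = 2 * (exp (- a\<^sup>2 * (t * (cos \<theta>)\<^sup>2)) * exp (- a\<^sup>2 * (t * (sin \<theta>)\<^sup>2)))
         * (resolvent a (sqrt t * cos \<theta>) * resolvent b (sqrt t * sin \<theta>))
         * (t * sin \<theta> * cos \<theta> / ((sqrt t * cos \<theta>) * (sqrt t * sin \<theta>)))"
      unfolding r_def c sq by simp
    also have "t * sin \<theta> * cos \<theta> / ((sqrt t * cos \<theta>) * (sqrt t * sin \<theta>)) = 1"
      using sc t by (simp add: field_simps)
    finally show ?thesis unfolding e by simp
  qed
  show "set_integrable lborel {0<..<t} (\<lambda>s. r a (t - s) * r b s)"
    by (rule set_integral_sin_substitution(1)[OF t f h eq])
  show "(LINT s:{0<..<t}|lborel. r a (t - s) * r b s)
      = 2 * exp (- a\<^sup>2 * t) * integral {0..pi / 2} (\<lambda>\<theta>. resolvent a (sqrt t * cos \<theta>) * resolvent b (sqrt t * sin \<theta>))"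
    using set_integral_sin_substitution(2)[OF t f h eq] by simp
qed

text \<open>By the equation for \<open>Y\<close> and the flux clause of the profile, the convolution
  and (a + b) q(0,t) have opposite derivatives for t > 0; continuity at 0 then fixes their
  sum.\<close>

lemma resolvent_convolution_eq_profile:
  assumes q: "robin_profile a b q qy qyy" and t: "t > 0"
  shows "2 * exp (- a\<^sup>2 * t) * integral {0..pi / 2} (\<lambda>\<theta>. resolvent a (sqrt t * cos \<theta>) * resolvent b (sqrt t * sin \<theta>))
    = 1 - (a + b) * q 0 t"
proof -
  define Y where "Y = (\<lambda>x. integral {0..pi / 2} (\<lambda>\<theta>. resolvent a (x * cos \<theta>) * resolvent b (x * sin \<theta>)))"
  have Y: "(Y has_real_derivative 2 * a\<^sup>2 * x * Y x - (a + b) * resolvent b x) (at x)" for x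
    unfolding Y_def by (rule integral_resolvent_cos_sin_ode)
  let ?h = "\<lambda>t. 2 * exp (- a\<^sup>2 * t) * Y (sqrt t) + (a + b) * q 0 t"
  have "?h t = ?h 0"
  proof (rule DERIV_isconst_end[OF t])
    have "continuous_on {0..t} (\<lambda>s. case (0, s) of (y, t) \<Rightarrow> q y t)"
      by (rule continuous_on_compose2[of "{0..} \<times> {0..}" "\<lambda>(y, t). q y t"])
        (use q in \<open>auto simp: robin_profile_def intro!: continuous_intros\<close>)
    then have 1: "continuous_on {0..t} (\<lambda>s. q 0 s)" by simp
    have "continuous_on UNIV Y"
      by (rule continuous_at_imp_continuous_on) (blast intro: DERIV_isCont[OF Y])
    then have 2: "continuous_on {0..t} (\<lambda>s. Y (sqrt s))"
      by (rule continuous_on_compose2) (auto intro: continuous_intros)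
    show "continuous_on {0..t} ?h"
      by (intro continuous_intros 1 2)
  next
    fix s assume "0 < s" "s < t"
    have q': "((\<lambda>s. q 0 s) has_real_derivative exp (- a\<^sup>2 * s) * resolvent b (sqrt s) / sqrt s) (at s)"
      using q \<open>0 < s\<close> unfolding robin_profile_def by metis
    have Y': "((\<lambda>s. Y (sqrt s)) has_real_derivative
        (2 * a\<^sup>2 * sqrt s * Y (sqrt s) - (a + b) * resolvent b (sqrt s)) * (inverse (sqrt s) / 2)) (at s)"
      by (rule DERIV_chain2[OF Y DERIV_real_sqrt]) fact
    have "((\<lambda>t. 2 * exp (- a\<^sup>2 * t)) has_real_derivative - 2 * a\<^sup>2 * exp (- a\<^sup>2 * s)) (at s)"
      by (auto intro!: derivative_eq_intros)
    from DERIV_add[OF DERIV_mult[OF this Y'] DERIV_cmult[OF q', of "a + b"]]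
    show "(?h has_real_derivative 0) (at s)"
      by (rule DERIV_cong) (use \<open>0 < s\<close> in \<open>simp add: field_simps\<close>)
  qed
  \<comment> \<open>At 0 both resolvents equal 1 / sqrt pi, so \<open>Y 0\<close> is 1/2, and q
    vanishes.\<close>
  also have "\<dots> = 1"
    using q by (simp add: Y_def robin_profile_def)
  finally show ?thesis by (simp add: Y_def)
qed

theorem lemma1p2:
  fixes a b c :: real
  assumes "a \<ge> 0" and "b > 0"
  shows "(\<forall>V. bounded_delta_solution a b (\<lambda>y. 1 - c * exp (- a * \<bar>y\<bar>)) V \<longrightarrow>
            (\<forall>\<xi>. \<xi> = (\<lambda>t. V 0 t) \<longrightarrow>
              (\<forall>t>0. \<xi> differentiable (at t) \<and>
                 set_integrable lborel {0<..<t} (\<lambda>s. m_kernel a (t - s) * deriv \<xi> s) \<and>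
                 (LINT s:{0<..<t}|lborel. m_kernel a (t - s) * deriv \<xi> s)
                   = - grad_E_sMM a b (\<xi> t)))) \<and>
         (\<forall>t>0. m_kernel a differentiable (at t) \<and> deriv (m_kernel a) t < 0 \<and> m_kernel a t > 0) \<and>
         (m_kernel a \<longlongrightarrow> 0) at_top"
proof (intro conjI allI impI)
  fix t :: real assume t: "t > 0"
  have neg: "- exp (- a\<^sup>2 * s) / (sqrt pi * s * sqrt s) < 0" if "s > 0" for s
    using that by (simp add: divide_neg_pos)
  show "m_kernel a differentiable (at t)"
    using DERIV_m_kernel[OF assms(1) t] real_differentiable_def by blast
  show "deriv (m_kernel a) t < 0"
    unfolding DERIV_imp_deriv[OF DERIV_m_kernel[OF assms(1) t]] by (rule neg[OF t])
  show "m_kernel a t > 0"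
    by (rule decreasing_tendsto_0_pos[OF DERIV_m_kernel[OF assms(1)] neg m_kernel_tendsto_0[OF assms(1)] t])
next
  show "(m_kernel a \<longlongrightarrow> 0) at_top" by (rule m_kernel_tendsto_0[OF assms(1)])
next
  fix V :: "real \<Rightarrow> real \<Rightarrow> real" and \<xi> :: "real \<Rightarrow> real" and t :: real
  assume V: "bounded_delta_solution a b (\<lambda>y. 1 - c * exp (- a * \<bar>y\<bar>)) V" and \<xi>: "\<xi> = (\<lambda>t. V 0 t)" and t: "t > 0"
  obtain q qy qyy where q: "robin_profile a b q qy qyy"
    using robin_profile_exists[OF assms] by blast
  define \<eta> where "\<eta> = b * (1 - c) - a * c"
  define r where "r = (\<lambda>k s. exp (- a\<^sup>2 * s) * resolvent k (sqrt s) / sqrt s)"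
  have \<xi>_eq: "\<xi> s = 1 - c - \<eta> * q 0 s" if "s \<ge> 0" for s
    unfolding \<xi> \<eta>_def by (rule delta_solution_at_0[OF assms V q that])
  have D: "(\<xi> has_real_derivative - \<eta> * r b s) (at s)" if s: "s > 0" for s
  proof (rule has_field_derivative_transform_within_open)
    have "((\<lambda>s. q 0 s) has_real_derivative r b s) (at s)"
      using q s unfolding robin_profile_def r_def by metis
    then show "((\<lambda>s. 1 - c - \<eta> * q 0 s) has_real_derivative - \<eta> * r b s) (at s)"
      by (auto intro!: derivative_eq_intros)
    show "s \<in> {0<..}" using s by simp
  qed (auto simp: \<xi>_eq)
  show "\<xi> differentiable (at t)"
    using D[OF t] real_differentiable_def by blast
  have m\<xi>: "m_kernel a (t - s) * deriv \<xi> s = (- 2 * \<eta>) * (r a (t - s) * r b s)" if "s \<in> {0<..<t}" for s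
    using that DERIV_imp_deriv[OF D[of s]] by (simp add: m_kernel_eq_resolvent assms r_def)
  have int: "set_integrable lborel {0<..<t} (\<lambda>s. r a (t - s) * r b s)"
    unfolding r_def by (rule set_integral_resolvent_convolution(1)[OF t])
  have val: "(LINT s:{0<..<t}|lborel. r a (t - s) * r b s) = 1 - (a + b) * q 0 t"
    unfolding r_def set_integral_resolvent_convolution(2)[OF t]
    by (rule resolvent_convolution_eq_profile[OF q t])
  show "set_integrable lborel {0<..<t} (\<lambda>s. m_kernel a (t - s) * deriv \<xi> s)"
    by (rule iffD2[OF set_integrable_cong[OF refl refl m\<xi>] set_integrable_mult_right[OF int]])
  have "(LINT s:{0<..<t}|lborel. m_kernel a (t - s) * deriv \<xi> s)
      = (LINT s:{0<..<t}|lborel. (- 2 * \<eta>) * (r a (t - s) * r b s))"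
    by (rule set_lebesgue_integral_cong) (use m\<xi> in auto)
  also have "\<dots> = - 2 * \<eta> * (1 - (a + b) * q 0 t)"
    unfolding set_integral_mult_right val ..
  \<comment> \<open>The gradient is affine with slope 2 (a + b) and takes the value 2 \<eta> at the
    initial point 1 - c.\<close>
  also have "\<dots> = - grad_E_sMM a b (\<xi> t)"
    using t by (simp add: grad_E_sMM_eq \<xi>_eq \<eta>_def algebra_simps)
  finally show "(LINT s:{0<..<t}|lborel. m_kernel a (t - s) * deriv \<xi> s) = - grad_E_sMM a b (\<xi> t)" .
qed

end
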